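(* If $G$ is a planar graph with girth at least 4, then $\chi^\star_c(G)\le 5$. More generally, $\chi^\star_c(G)\le 5$ for every graph $G$ with maximum average degree less than 4.
   Context: Graphs are finite and simple. The maximum average degree of $G$ is the maximum of $2|E(H)|/|V(H)|$ over all nonempty subgraphs $H$ of $G$. For a positive integer $k$, a $k$-cover of a graph $G$ is a pair $(\vec D,\sigma)$ where $\vec D$ is an orientation of $G$ and $\sigma$ assigns to each arc of $\vec D$ a permutation of $[k]$. A $(\vec D,\sigma)$-coloring is a map $\varphi:V(G)\to[k]$ with $\sigma(vw)(\varphi(v))\ne\varphi(w)$ for every arc $vw$. A $(\vec D,\sigma)$-packing is a collection $\varphi_1,\dots,\varphi_k$ of $(\vec D,\sigma)$-colorings with $\varphi_i(v)\ne\varphi_j(v)$ for every vertex $v$ and all distinct $i,j\in[k]$. $\chi^\star_c(G)$ is the minimum $k$ such that $G$ has a $(\vec D,\sigma)$-packing for every $k$-cover of $G$. *)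

theory Defs
  imports "HOL-Analysis.Analysis" "HOL-Library.Extended_Nat" "HOL-Combinatorics.Permutations"
begin

text \<open>A finite simple graph is given by its vertex set and its edge set, where an edge is the
  two-element set of its endpoints.\<close>

definition fin_simple_graph :: "'a set \<Rightarrow> 'a set set \<Rightarrow> bool" where
  "fin_simple_graph V E \<longleftrightarrow> finite V \<and> (\<forall>e\<in>E. e \<subseteq> V \<and> card e = 2)"

definition is_subgraph :: "'a set \<Rightarrow> 'a set set \<Rightarrow> 'a set \<Rightarrow> 'a set set \<Rightarrow> bool" where
  "is_subgraph W F V E \<longleftrightarrow> W \<subseteq> V \<and> F \<subseteq> E \<and> (\<forall>e\<in>F. e \<subseteq> W)"

text \<open>The value on the null graph, which has no nonempty subgraph, is unspecified.\<close>

definition max_avg_degree :: "'a set \<Rightarrow> 'a set set \<Rightarrow> real" where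
  "max_avg_degree V E =
     Max {2 * real (card F) / real (card W) | W F. is_subgraph W F V E \<and> W \<noteq> {}}"

text \<open>A cycle is listed by its vertices, without repeating the first one at the end.\<close>

definition is_cycle :: "'a set set \<Rightarrow> 'a list \<Rightarrow> bool" where
  "is_cycle E vs \<longleftrightarrow> length vs \<ge> 3 \<and> distinct vs \<and>
     (\<forall>i < length vs. {vs ! i, vs ! (Suc i mod length vs)} \<in> E)"

text \<open>Forests have girth \<open>\<infinity>\<close>, the infimum of the empty set.\<close>

definition girth :: "'a set set \<Rightarrow> enat" where
  "girth E = (INF vs \<in> {vs. is_cycle E vs}. enat (length vs))"

text \<open>Planarity is topological: vertices are drawn as distinct points of the plane and edges as
  arcs (injective continuous paths) joining their endpoints, such that an arc contains no other
  vertex and two distinct arcs meet at most in common endpoints.\<close>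

definition plane_drawing ::
  "'a set \<Rightarrow> 'a set set \<Rightarrow> ('a \<Rightarrow> complex) \<Rightarrow> ('a set \<Rightarrow> real \<Rightarrow> complex) \<Rightarrow> bool" where
  "plane_drawing V E pt \<gamma> \<longleftrightarrow>
     inj_on pt V \<and>
     (\<forall>e\<in>E. arc (\<gamma> e) \<and> {pathstart (\<gamma> e), pathfinish (\<gamma> e)} = pt ` e \<and>
             path_image (\<gamma> e) \<inter> pt ` V = pt ` e) \<and>
     (\<forall>e\<in>E. \<forall>f\<in>E. e \<noteq> f \<longrightarrow> path_image (\<gamma> e) \<inter> path_image (\<gamma> f) = pt ` (e \<inter> f))"

definition planar :: "'a set \<Rightarrow> 'a set set \<Rightarrow> bool" where
  "planar V E \<longleftrightarrow> (\<exists>pt \<gamma>. plane_drawing V E pt \<gamma>)"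

definition is_orientation :: "'a set set \<Rightarrow> ('a \<times> 'a) set \<Rightarrow> bool" where
  "is_orientation E D \<longleftrightarrow>
     (\<forall>u v. (u, v) \<in> D \<longrightarrow> {u, v} \<in> E) \<and>
     (\<forall>u v. {u, v} \<in> E \<longrightarrow> ((u, v) \<in> D \<longleftrightarrow> (v, u) \<notin> D))"

definition is_cover ::
  "nat \<Rightarrow> 'a set set \<Rightarrow> ('a \<times> 'a) set \<Rightarrow> ('a \<times> 'a \<Rightarrow> nat \<Rightarrow> nat) \<Rightarrow> bool" where
  "is_cover k E D \<sigma> \<longleftrightarrow> is_orientation E D \<and> (\<forall>a\<in>D. \<sigma> a permutes {1..k})"

definition is_coloring ::
  "nat \<Rightarrow> 'a set \<Rightarrow> ('a \<times> 'a) set \<Rightarrow> ('a \<times> 'a \<Rightarrow> nat \<Rightarrow> nat) \<Rightarrow> ('a \<Rightarrow> nat) \<Rightarrow> bool" where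
  "is_coloring k V D \<sigma> \<phi> \<longleftrightarrow>
     \<phi> \<in> V \<rightarrow> {1..k} \<and> (\<forall>v w. (v, w) \<in> D \<longrightarrow> \<sigma> (v, w) (\<phi> v) \<noteq> \<phi> w)"

definition is_packing ::
  "nat \<Rightarrow> 'a set \<Rightarrow> ('a \<times> 'a) set \<Rightarrow> ('a \<times> 'a \<Rightarrow> nat \<Rightarrow> nat) \<Rightarrow> (nat \<Rightarrow> 'a \<Rightarrow> nat) \<Rightarrow> bool" where
  "is_packing k V D \<sigma> \<phi> \<longleftrightarrow>
     (\<forall>i\<in>{1..k}. is_coloring k V D \<sigma> (\<phi> i)) \<and>
     (\<forall>v\<in>V. \<forall>i\<in>{1..k}. \<forall>j\<in>{1..k}. i \<noteq> j \<longrightarrow> \<phi> i v \<noteq> \<phi> j v)"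

text \<open>Taken in \<open>enat\<close>, so that the infimum is an attained minimum whenever some \<open>k\<close>
  qualifies and \<open>\<infinity>\<close> otherwise; a finite upper bound thus always yields a suitable \<open>k\<close>.\<close>

definition corr_packing_number :: "'a set \<Rightarrow> 'a set set \<Rightarrow> enat" where
  "corr_packing_number V E =
     (INF k \<in> {k. k > 0 \<and> (\<forall>D \<sigma>. is_cover k E D \<sigma> \<longrightarrow> (\<exists>\<phi>. is_packing k V D \<sigma> \<phi>))}. enat k)"

end

theory Submission
  imports Defs
begin

text \<open>
  Fix a \<open>5\<close>-cover. A packing is a choice of a permutation of the five colours at each vertex,
  and the packing at each neighbour of \<open>v\<close> forbids one permutation pointwise at \<open>v\<close>. By Hall's
  theorem two forbidden permutations can always be avoided, and three cannot only if they form a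
  Latin square of order three on some three indices; given two of the permutations, all possible
  third ones therefore agree on three indices. Hence a vertex of degree three can be added to a
  packing after recolouring one neighbour, provided this neighbour can be changed on those indices,
  which holds if its degree is at most four; a vertex of degree five can be recoloured to suit four
  neighbours of degree three at once. Discharging shows that graphs with fewer than
  \<open>2|V(H)|\<close> edges in each nonempty subgraph \<open>H\<close> always contain one of these configurations.

  For plane graphs without triangles this edge bound is Euler's inequality. By Janiszewski's
  theorem, a minimal set of edges separating two points has no vertex of degree one, so it has at
  least four edges; an edge separates at most two faces, since it lies on a Jordan curve that meets
  the remaining drawing in a connected set; and every edge that is not a bridge splits a face.
\<close>

section \<open>Permutations avoiding given permutations\<close>

text \<open>Halmos-Vaughan induction: a tight nonempty proper subfamily \<open>J\<close> is matched
  first and its values are removed from the other sets. If there is none, every nonempty proper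
  subfamily has a value to spare, so any \<open>i\<close> may take any \<open>a\<close> in
  \<open>A i\<close>.\<close>

theorem Hall_marriage:
  assumes "finite I" "\<And>i. i \<in> I \<Longrightarrow> finite (A i)"
    and "\<And>J. J \<subseteq> I \<Longrightarrow> card J \<le> card (\<Union>(A ` J))"
  shows "\<exists>f. inj_on f I \<and> (\<forall>i\<in>I. f i \<in> A i)"
  using assms
proof (induction I arbitrary: A rule: finite_psubset_induct)
  case (psubset I)
  have finU: "finite (\<Union>(A ` J))" if "J \<subseteq> I" for J
    using that psubset.hyps psubset.prems(1) by (meson finite_UN finite_subset subsetD)
  show ?case
  proof (cases "\<exists>J. J \<noteq> {} \<and> J \<subset> I \<and> card (\<Union>(A ` J)) = card J")
    case True
    then obtain J where J: "J \<noteq> {}" "J \<subset> I" "card (\<Union>(A ` J)) = card J" by blast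
    have finJ: "finite J" using J psubset.hyps finite_subset by blast
    obtain f where f: "inj_on f J" "\<forall>i\<in>J. f i \<in> A i"
      using psubset.IH[OF J(2), of A] psubset.prems J(2) by (metis psubsetE subsetD order_trans)
    define A' where "A' i = A i - \<Union>(A ` J)" for i
    have "\<exists>g. inj_on g (I - J) \<and> (\<forall>i\<in>I - J. g i \<in> A' i)"
    proof (rule psubset.IH)
      show "I - J \<subset> I" using J by blast
      show "finite (A' i)" if "i \<in> I - J" for i
        using that psubset.prems(1) by (auto simp: A'_def)
      fix K assume K: "K \<subseteq> I - J"
      then have finK: "finite K" using psubset.hyps finite_subset by blast
      have sub: "J \<union> K \<subseteq> I" using J K by auto
      \<comment> \<open>As \<open>J\<close> is tight, subtracting its values from Hall's inequality
        for \<open>J \<union> K\<close> leaves Hall's inequality for \<open>K\<close>.\<close>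
      have "card J + card K = card (J \<union> K)"
        using K finJ finK by (subst card_Un_disjoint) auto
      also have "\<dots> \<le> card (\<Union>(A ` (J \<union> K)))" using psubset.prems(2) sub by blast
      also have "\<dots> = card (\<Union>(A' ` K) \<union> \<Union>(A ` J))"
        by (rule arg_cong[of _ _ card]) (auto simp: A'_def)
      also have "\<dots> \<le> card (\<Union>(A' ` K)) + card (\<Union>(A ` J))"
        by (rule card_Un_le)
      finally show "card K \<le> card (\<Union>(A' ` K))" using J by simp
    qed
    then obtain g where g: "inj_on g (I - J)" "\<forall>i\<in>I - J. g i \<in> A' i" by blast
    have "inj_on (\<lambda>i. if i \<in> J then f i else g i) I"
    proof (rule inj_onI)
      fix x y assume xy: "x \<in> I" "y \<in> I" "(if x \<in> J then f x else g x) = (if y \<in> J then f y else g y)"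
      have *: "g y \<noteq> f x" if "x \<in> J" "y \<in> I - J" for x y
        using that f(2) g(2) unfolding A'_def by (metis DiffD2 UN_I)
      show "x = y"
        using xy *[of x y] *[of y x] inj_onD[OF f(1), of x y] inj_onD[OF g(1), of x y]
        by (auto split: if_splits)
    qed
    moreover have "\<forall>i\<in>I. (if i \<in> J then f i else g i) \<in> A i"
      using f g by (auto simp: A'_def)
    ultimately show ?thesis by blast
  next
    case False
    show ?thesis
    proof (cases "I = {}")
      case False2: False
      then obtain i where i: "i \<in> I" by blast
      have "card {i} \<le> card (\<Union>(A ` {i}))" using psubset.prems(2) i by blast
      then obtain a where a: "a \<in> A i" by (cases "A i = {}") auto
      define A' where "A' j = A j - {a}" for j
      have "\<exists>g. inj_on g (I - {i}) \<and> (\<forall>j\<in>I - {i}. g j \<in> A' j)"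
      proof (rule psubset.IH)
        show "I - {i} \<subset> I" using i by blast
        show "finite (A' j)" if "j \<in> I - {i}" for j
          using that psubset.prems(1) by (auto simp: A'_def)
        fix K assume K: "K \<subseteq> I - {i}"
        show "card K \<le> card (\<Union>(A' ` K))"
        proof (cases "K = {}")
          case False3: False
          have "K \<subset> I" using K i by blast
          then have "card K < card (\<Union>(A ` K))"
            using False False3 psubset.prems(2)[of K] by (metis le_neq_implies_less psubsetE)
          also have "card (\<Union>(A ` K)) \<le> card (insert a (\<Union>(A' ` K)))"
            using finU[of K] K by (intro card_mono) (auto simp: A'_def)
          also have "\<dots> \<le> Suc (card (\<Union>(A' ` K)))"
            by (rule card_insert_le_m1) auto
          finally show ?thesis by simp
        qed simp
      qed
      then obtain g where g: "inj_on g (I - {i})" "\<forall>j\<in>I - {i}. g j \<in> A' j" by blast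
      have "inj_on (g(i := a)) I"
        using g by (auto simp: inj_on_def A'_def)
      moreover have "\<forall>j\<in>I. (g(i := a)) j \<in> A j" using g a by (auto simp: A'_def)
      ultimately show ?thesis by blast
    qed simp
  qed
qed

text \<open>The Frobenius-Koenig alternative: if Hall's condition fails for \<open>J\<close>, then
  \<open>J\<close> and the values of \<open>B\<close> allowed nowhere on \<open>J\<close> span an
  entirely forbidden rectangle.\<close>

lemma permutation_or_forbidden_rectangle:
  assumes fin: "finite B"
  obtains (perm) p where "p permutes B" "\<And>i. i \<in> B \<Longrightarrow> \<not> forb i (p i)"
  | (rect) X T where "X \<subseteq> B" "T \<subseteq> B" "card B < card X + card T"
      "\<And>i c. i \<in> X \<Longrightarrow> c \<in> T \<Longrightarrow> forb i c"
proof (cases "\<forall>J. J \<subseteq> B \<longrightarrow> card J \<le> card (\<Union>((\<lambda>i. {c \<in> B. \<not> forb i c}) ` J))")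
  case True
  then obtain f where f: "inj_on f B" "\<forall>i\<in>B. f i \<in> {c \<in> B. \<not> forb i c}"
    using Hall_marriage[OF fin, of "\<lambda>i. {c \<in> B. \<not> forb i c}"] fin by auto
  define p where "p i = (if i \<in> B then f i else i)" for i
  have "inj_on p B" "p ` B \<subseteq> B" using f by (auto simp: p_def inj_on_def)
  then have "bij_betw p B B" using fin by (simp add: bij_betw_def endo_inj_surj)
  then have "p permutes B" by (rule bij_imp_permutes) (simp add: p_def)
  then show ?thesis using f perm by (auto simp: p_def)
next
  case False
  then obtain J where J: "J \<subseteq> B" "card (\<Union>((\<lambda>i. {c \<in> B. \<not> forb i c}) ` J)) < card J"
    by (auto simp: not_le)
  let ?N = "\<Union>((\<lambda>i. {c \<in> B. \<not> forb i c}) ` J)"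
  have "?N \<subseteq> B" by auto
  then have "card (B - ?N) = card B - card ?N" "card ?N \<le> card B"
    using fin finite_subset by (auto intro!: card_Diff_subset card_mono)
  then show ?thesis using J by (intro rect[of J "B - ?N"]) auto
qed

section \<open>Sets of permutations of five colours that cannot be avoided\<close>

definition avoids :: "'b set \<Rightarrow> ('b \<Rightarrow> 'b) set \<Rightarrow> ('b \<Rightarrow> 'b) \<Rightarrow> bool" where
  "avoids B M p \<longleftrightarrow> (\<forall>m\<in>M. \<forall>i\<in>B. p i \<noteq> m i)"

definition blocked :: "'b set \<Rightarrow> ('b \<Rightarrow> 'b) set \<Rightarrow> bool" where
  "blocked B M \<longleftrightarrow> (\<nexists>p. p permutes B \<and> avoids B M p)"

lemma card_row_le:
  assumes "finite M" "T \<subseteq> (\<lambda>m. m i) ` M"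
  shows "card T \<le> card M"
  using assms by (meson card_image_le card_mono finite_imageI le_trans)

text \<open>A permutation \<open>m\<close> takes the value \<open>c\<close> only at
  \<open>inv m c\<close>, so each member of \<open>M\<close> accounts for one index.\<close>

lemma card_column_le:
  assumes "finite M" "\<forall>m\<in>M. m permutes B" "\<forall>i\<in>X. \<exists>m\<in>M. m i = c"
  shows "card X \<le> card M"
proof -
  have "X \<subseteq> (\<lambda>m. inv m c) ` M"
    using assms by (force simp: permutes_inverses image_iff)
  then show ?thesis using assms(1) by (meson card_image_le card_mono finite_imageI le_trans)
qed

text \<open>Three permutations bound both sides of the forbidden rectangle by three while the sum of
  the sides exceeds five, so it is three by three. On its indices the members of \<open>M\<close>
  then have no room for values outside \<open>T\<close>.\<close>

lemma blocked_latin_square: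
  assumes B: "finite B" "card B = 5" and M: "finite M" "card M \<le> 3" "\<forall>m\<in>M. m permutes B"
    and bl: "blocked B M"
  obtains S T where "S \<subseteq> B" "card S = 3" "card T = 3" "\<And>i. i \<in> S \<Longrightarrow> (\<lambda>m. m i) ` M = T"
proof (rule permutation_or_forbidden_rectangle[OF B(1), of "\<lambda>i c. \<exists>m\<in>M. m i = c"])
  fix p assume "p permutes B" "\<And>i. i \<in> B \<Longrightarrow> \<not> (\<exists>m\<in>M. m i = p i)"
  then show thesis using bl by (fastforce simp: blocked_def avoids_def)
next
  fix X T assume XT: "X \<subseteq> B" "T \<subseteq> B" "card B < card X + card T"
    "\<And>i c. i \<in> X \<Longrightarrow> c \<in> T \<Longrightarrow> \<exists>m\<in>M. m i = c"
  have fin: "finite X" "finite T" using XT B finite_subset by auto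
  have le: "card X \<le> 5" "card T \<le> 5" using XT(1,2) B by (metis card_mono)+
  then have ne: "X \<noteq> {}" "T \<noteq> {}" using XT(3) B by auto
  have row: "T \<subseteq> (\<lambda>m. m i) ` M" if "i \<in> X" for i using XT(4)[OF that] by fastforce
  have "card T \<le> 3" using row ne card_row_le[OF M(1)] M(2) by (meson ex_in_conv le_trans)
  moreover have "card X \<le> 3" using XT(4) ne card_column_le[OF M(1,3)] M(2) by (meson ex_in_conv le_trans)
  ultimately have 3: "card X = 3" "card T = 3" using XT(3) B by auto
  have "(\<lambda>m. m i) ` M = T" if "i \<in> X" for i
    using row[OF that] card_image_le[OF M(1), of "\<lambda>m. m i"] M(1,2) 3
    by (metis card_seteq finite_imageI le_trans)
  then show thesis using that XT 3 by blast
qed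

text \<open>Each index of the Latin square needs three values, and two permutations supply at most
  two.\<close>

lemma not_blocked_two:
  assumes B: "finite B" "card B = 5" and M: "finite M" "card M \<le> 2" "\<forall>m\<in>M. m permutes B"
  shows "\<not> blocked B M"
proof
  assume "blocked B M"
  then obtain S T where S: "card S = 3" "card T = 3" "\<And>i. i \<in> S \<Longrightarrow> (\<lambda>m. m i) ` M = T"
    using blocked_latin_square[OF B M(1) _ M(3)] M(2)
    by (metis eval_nat_numeral(3) le_SucI)
  then obtain i where "i \<in> S" by fastforce
  then show False using S card_image_le[OF M(1), of "\<lambda>m. m i"] M(2) by auto
qed

text \<open>On \<open>S\<close> the two permutations in \<open>N\<close> are the first two rows of a Latin square of order three,
  so the third row is determined; and \<open>S\<close> is the only three-element set they both map onto the
  same set without agreeing anywhere on it.\<close>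

lemma blocking_agree:
  assumes B: "finite B" "card B = 5" and N: "finite N" "card N \<le> 2" "\<forall>m\<in>N. m permutes B"
    and \<pi>: "\<pi> permutes B"
  obtains S where "S \<subseteq> B" "card S = 3"
    "\<And>q q'. q permutes B \<Longrightarrow> q' permutes B \<Longrightarrow> blocked B (insert (\<pi> \<circ> q) N) \<Longrightarrow>
       blocked B (insert (\<pi> \<circ> q') N) \<Longrightarrow> \<forall>i\<in>S. q i = q' i"
proof (cases "\<exists>q. q permutes B \<and> blocked B (insert (\<pi> \<circ> q) N)")
  case False
  \<comment> \<open>No \<open>q\<close> blocks, so the agreement claim is vacuous and any three
    indices serve as \<open>S\<close>.\<close>
  obtain S where "S \<subseteq> B" "card S = 3"
    using obtain_subset_with_card_n[of 3 B] B by auto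
  then show ?thesis using that False by blast
next
  case True
  have square: "\<exists>S T. S \<subseteq> B \<and> card S = 3 \<and> card T = 3 \<and>
      (\<forall>i\<in>S. insert (\<pi> (q i)) ((\<lambda>m. m i) ` N) = T)"
    if q: "q permutes B" "blocked B (insert (\<pi> \<circ> q) N)" for q
  proof -
    have "card (insert (\<pi> \<circ> q) N) \<le> 3"
      using N by (simp add: card_insert_if)
    moreover have "\<forall>m\<in>insert (\<pi> \<circ> q) N. m permutes B"
      using N \<pi> q by (simp add: permutes_compose)
    ultimately obtain S T where "S \<subseteq> B" "card S = 3" "card T = 3"
        "\<And>i. i \<in> S \<Longrightarrow> (\<lambda>m. m i) ` insert (\<pi> \<circ> q) N = T"
      using blocked_latin_square[OF B _ _ _ q(2)] N by (metis finite_insert)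
    then show ?thesis by (intro exI[of _ S] exI[of _ T]) auto
  qed
  obtain q0 S T where q0: "q0 permutes B" and S: "S \<subseteq> B" "card S = 3" "card T = 3"
      "\<forall>i\<in>S. insert (\<pi> (q0 i)) ((\<lambda>m. m i) ` N) = T"
    using True square by metis
  have finS: "finite S" using S B finite_subset by blast
  obtain i0 where i0: "i0 \<in> S" using S(2) by fastforce
  have "card N = 2"
  proof (rule ccontr)
    assume "card N \<noteq> 2"
    then have "card ((\<lambda>m. m i0) ` N) \<le> 1" using N card_image_le[OF N(1), of "\<lambda>m. m i0"] by linarith
    then have "card (insert (\<pi> (q0 i0)) ((\<lambda>m. m i0) ` N)) \<le> 2"
      using N(1) by (simp add: card_insert_if)
    then show False using S i0 by auto
  qed
  then obtain n1 n2 where n: "N = {n1, n2}" by (auto simp: card_2_iff)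
  have perm: "n1 permutes B" "n2 permutes B" using N n by auto
  have facts: "n1 ` S' = T'" "n2 ` S' = T'" "\<forall>i\<in>S'. n1 i \<noteq> n2 i \<and> \<pi> (q i) \<notin> {n1 i, n2 i}"
    if T': "card S' = 3" "card T' = 3" "\<forall>i\<in>S'. insert (\<pi> (q i)) ((\<lambda>m. m i) ` N) = T'" for q S' T'
  proof -
    have fin: "finite S'" "finite T'" using T' by (metis card.infinite zero_neq_numeral)+
    have "card (n1 ` S') = 3" "card (n2 ` S') = 3"
      using perm T'(1) by (simp_all add: card_image permutes_inj_on)
    moreover have "n1 ` S' \<subseteq> T'" "n2 ` S' \<subseteq> T'" using T'(3) n by auto
    ultimately show "n1 ` S' = T'" "n2 ` S' = T'"
      using fin T'(2) by (simp_all add: card_subset_eq)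
    show "\<forall>i\<in>S'. n1 i \<noteq> n2 i \<and> \<pi> (q i) \<notin> {n1 i, n2 i}"
    proof (rule ballI, rule ccontr)
      fix i assume i: "i \<in> S'" and c: "\<not> (n1 i \<noteq> n2 i \<and> \<pi> (q i) \<notin> {n1 i, n2 i})"
      have "card {\<pi> (q i), n1 i, n2 i} = 3" using T' i n by auto
      then show False using c by (auto simp: card_insert_if split: if_splits)
    qed
  qed
  note fS = facts[OF S(2-4)]
  show ?thesis
  proof (rule that[OF S(1,2)], rule ballI)
    fix q q' i
    assume q: "q permutes B" "blocked B (insert (\<pi> \<circ> q) N)"
      and q': "q' permutes B" "blocked B (insert (\<pi> \<circ> q') N)" and i: "i \<in> S"
    have uniq: "\<pi> (r i) \<in> T \<and> \<pi> (r i) \<notin> {n1 i, n2 i}"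
      if r: "r permutes B" "blocked B (insert (\<pi> \<circ> r) N)" for r
    proof -
      obtain S' T' where S': "S' \<subseteq> B" "card S' = 3" "card T' = 3"
          "\<forall>i\<in>S'. insert (\<pi> (r i)) ((\<lambda>m. m i) ` N) = T'"
        using square[OF r] by blast
      note fS' = facts[OF S'(2-4)]
      have finS': "finite S'" using S' B finite_subset by blast
      \<comment> \<open>Both \<open>n1\<close> and \<open>n2\<close> map
        \<open>S \<inter> S'\<close> onto \<open>T \<inter> T'\<close> and \<open>S - S'\<close>
        onto \<open>T - T'\<close>. A piece with one element would be an agreement of
        \<open>n1\<close> and \<open>n2\<close>. The intersection has at least 3 + 3 - 5 = 1
        elements, so it must be all of \<open>S\<close>.\<close>
      have eqI: "n1 ` (S \<inter> S') = n2 ` (S \<inter> S')"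
        using fS fS' perm by (metis image_Int permutes_inj)
      have eqD: "n1 ` (S - S') = n2 ` (S - S')"
        using fS fS' perm by (metis image_set_diff permutes_inj)
      have no1: "card K \<noteq> 1" if "K \<subseteq> S" "n1 ` K = n2 ` K" for K
      proof
        assume "card K = 1"
        then obtain k where "K = {k}" by (auto simp: card_1_singleton_iff)
        then show False using that fS(3) by auto
      qed
      have "card (S \<union> S') \<le> 5" using S S' B by (metis card_mono sup_least)
      then have "card (S \<inter> S') \<ge> 1"
        using card_Un_Int[OF finS finS'] S S' by linarith
      moreover have "card (S \<inter> S') \<noteq> 1" "card (S - S') \<noteq> 1"
        using no1 eqI eqD by auto
      moreover have "card (S - S') + card (S \<inter> S') = 3"
        using S(2) finS by (metis add.commute card_Int_Diff)
      ultimately have "card (S - S') = 0" by linarith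
      then have "S = S'" using S S' finS finS' by (simp add: card_subset_eq)
      then have "T = T'" using fS(1) fS'(1) by simp
      then show ?thesis using S'(4) fS'(3) \<open>S = S'\<close> i by auto
    qed
    have "n1 i \<in> T" "n2 i \<in> T" "n1 i \<noteq> n2 i" using fS i by auto
    moreover have "finite T" using S by (metis card.infinite zero_neq_numeral)
    ultimately have "card (T - {n1 i, n2 i}) = 1"
      using S(3) by (simp add: card_Diff_subset)
    then obtain t where "T - {n1 i, n2 i} = {t}" by (auto simp: card_1_singleton_iff)
    moreover have "\<pi> (q i) \<in> T - {n1 i, n2 i}" "\<pi> (q' i) \<in> T - {n1 i, n2 i}"
      using uniq[OF q] uniq[OF q'] by simp_all
    ultimately have "\<pi> (q i) = \<pi> (q' i)" by simp
    then show "q i = q' i" using permutes_inj[OF \<pi>] by (meson injD)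
  qed
qed

lemma avoids_swap:
  assumes p: "p permutes B" "avoids B M p" and xy: "x \<in> B" "y \<in> B"
    and "\<forall>m\<in>M. m x \<noteq> p y" "\<forall>m\<in>M. m y \<noteq> p x"
  shows "p \<circ> Transposition.transpose x y permutes B" "avoids B M (p \<circ> Transposition.transpose x y)"
proof -
  show "p \<circ> Transposition.transpose x y permutes B"
    using p xy by (simp add: permutes_compose permutes_swap_id)
  show "avoids B M (p \<circ> Transposition.transpose x y)"
    using assms by (auto simp: avoids_def Transposition.transpose_def)
qed

text \<open>The value \<open>p s\<close> at some \<open>s\<close> in \<open>S\<close> is forbidden
  in addition. If this blocks everything, the obstruction is a three by three rectangle in which
  \<open>(s, p s)\<close> is the only cell not covered by \<open>M\<close>. Its rigid structure then
  allows a swap that changes \<open>p\<close> at a second point \<open>s'\<close> of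
  \<open>S\<close>.\<close>

lemma avoids_change_on:
  assumes B: "finite B" "card B = 5" and M: "finite M" "card M \<le> 3" "\<forall>m\<in>M. m permutes B"
    and p: "p permutes B" "avoids B M p" and S: "S \<subseteq> B" "card S = 3"
  shows "\<exists>q. q permutes B \<and> avoids B M q \<and> (\<exists>i\<in>S. q i \<noteq> p i)"
proof -
  obtain s s' where s: "s \<in> S" "s' \<in> S" "s \<noteq> s'"
    using S(2) by (auto simp: card_3_iff)
  have pm: "m i \<noteq> p i" if "m \<in> M" "i \<in> B" for m i using p that by (force simp: avoids_def)
  show ?thesis
  proof (rule permutation_or_forbidden_rectangle[OF B(1), of "\<lambda>i c. (\<exists>m\<in>M. m i = c) \<or> i = s \<and> c = p s"])
    fix q assume q: "q permutes B" "\<And>i. i \<in> B \<Longrightarrow> \<not> ((\<exists>m\<in>M. m i = q i) \<or> i = s \<and> q i = p s)"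
    then have "avoids B M q" by (force simp: avoids_def)
    moreover have "q s \<noteq> p s" using q(2)[of s] s S by auto
    ultimately show ?thesis using q s by blast
  next
    fix X T assume XT: "X \<subseteq> B" "T \<subseteq> B" "card B < card X + card T"
      and forb: "\<And>i c. i \<in> X \<Longrightarrow> c \<in> T \<Longrightarrow> (\<exists>m\<in>M. m i = c) \<or> i = s \<and> c = p s"
    have fin: "finite X" "finite T" using XT B finite_subset by auto
    \<comment> \<open>Since \<open>p\<close> avoids \<open>M\<close>, its graph can meet the
      rectangle only in the extra cell; since the sides add up to more than five, it does meet
      it.\<close>
    have only: "i = s" if "i \<in> X" "p i \<in> T" for i
      using forb[OF that] pm XT(1) that by blast
    have cardp: "card (p ` K) = card K" for K
      using p(1) by (simp add: card_image permutes_inj_on)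
    have "p ` X \<inter> T \<noteq> {}"
    proof
      assume "p ` X \<inter> T = {}"
      then have "card X + card T = card (p ` X \<union> T)" using fin cardp by (simp add: card_Un_disjoint)
      also have "\<dots> \<le> card B" using XT p B by (intro card_mono) (auto simp: permutes_in_image)
      finally show False using XT by simp
    qed
    then have sX: "s \<in> X" and sT: "p s \<in> T" using only by auto
    have "card (T - {p s}) \<le> card M"
      using forb[OF sX] by (intro card_row_le[OF M(1), of _ s]) fastforce
    then have "card T \<le> 4" using M(2) sT fin by simp
    moreover have "card (X - {s}) \<le> card M"
      using forb[OF _ sT] by (intro card_column_le[OF M(1,3), of _ "p s"]) blast
    then have "card X \<le> 4" using M(2) sX fin by simp
    ultimately have "card X \<ge> 2" "card T \<ge> 2" using XT(3) B by auto
    then have "card (X - {s}) \<ge> 1" "card (T - {p s}) \<ge> 1" using sX sT fin by auto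
    then have "X - {s} \<noteq> {}" "T - {p s} \<noteq> {}" by (metis card.empty not_one_le_zero)+
    then obtain x c where xc: "x \<in> X" "x \<noteq> s" "c \<in> T" "c \<noteq> p s" by blast
    have row: "T \<subseteq> (\<lambda>m. m i) ` M" if "i \<in> X" "i \<noteq> s" for i
      using forb[OF that(1)] that(2) by fastforce
    have col: "\<forall>i\<in>X. \<exists>m\<in>M. m i = c" if "c \<in> T" "c \<noteq> p s" for c
      using forb[OF _ that(1)] that(2) by blast
    have "card T \<le> 3" "card X \<le> 3"
      using card_row_le[OF M(1) row[OF xc(1,2)]] card_column_le[OF M(1,3) col[OF xc(3,4)]] M(2) by auto
    then have 3: "card T = 3" "card X = 3" using XT(3) B by auto
    have row_eq: "(\<lambda>m. m i) ` M = T" if "i \<in> X" "i \<noteq> s" for i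
      using row[OF that] card_image_le[OF M(1), of "\<lambda>m. m i"] M(1,2) 3
      by (metis card_seteq finite_imageI le_trans)
    \<comment> \<open>A value of \<open>T\<close> other than \<open>p s\<close> is taken once by
      each of at most three permutations and already at all three indices of \<open>X\<close>, hence
      nowhere else.\<close>
    have col_eq: "i \<in> X" if "m \<in> M" "m i = c" "c \<in> T" "c \<noteq> p s" for m i c
    proof (rule ccontr)
      assume "i \<notin> X"
      moreover have "card (insert i X) \<le> card M"
        using col[OF that(3,4)] that by (intro card_column_le[OF M(1,3), of _ c]) auto
      ultimately show False using fin 3 M(2) by simp
    qed
    \<comment> \<open>Two values of \<open>p\<close> and the three elements of \<open>T\<close>
      exhaust the five colours, so \<open>s'\<close> lies in \<open>X - {s}\<close> or
      \<open>p s'\<close> lies in \<open>T\<close>.\<close>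
    have "p ` (X - {s}) \<inter> T = {}" using only by auto
    then have "card (p ` (X - {s}) \<union> T) = 5"
      using fin 3 sX by (simp add: card_Un_disjoint cardp)
    then have cover: "p ` (X - {s}) \<union> T = B"
      using XT p B by (intro card_subset_eq) (auto simp: permutes_in_image)
    have s'B: "s' \<in> B" "p s' \<in> B" using s S p by (auto simp: permutes_in_image)
    then consider "s' \<in> X - {s}" | "p s' \<in> T"
      using cover inj_image_mem_iff[OF permutes_inj[OF p(1)], of s' "X - {s}"] by blast
    then obtain y where y: "y \<in> B" "y \<noteq> s'" "\<forall>m\<in>M. m s' \<noteq> p y" "\<forall>m\<in>M. m y \<noteq> p s'"
    proof cases
      case 1
      \<comment> \<open>Swap partner: the other index of \<open>X - {s}\<close>. At both indices
        \<open>M\<close> has values in \<open>T\<close> only, and \<open>p\<close> has values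
        outside \<open>T\<close>.\<close>
      have "card (X - {s} - {s'}) = 1" using 1 fin 3 sX by simp
      then obtain y where "X - {s} - {s'} = {y}" by (auto simp: card_1_singleton_iff)
      then have y: "y \<in> X" "y \<noteq> s" "y \<noteq> s'" by blast+
      have "p y \<notin> T" "p s' \<notin> T" using only y 1 by auto
      moreover have "\<forall>m\<in>M. m s' \<in> T" "\<forall>m\<in>M. m y \<in> T"
        using row_eq[of y] row_eq[of s'] y 1 by auto
      ultimately have "\<forall>m\<in>M. m s' \<noteq> p y" "\<forall>m\<in>M. m y \<noteq> p s'"
        by metis+
      then show ?thesis using that y XT by auto
    next
      case 2
      \<comment> \<open>Swap partner: the index where \<open>p\<close> takes the third value of
        \<open>T\<close>. Both indices lie outside \<open>X\<close>, where \<open>M\<close> takes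
        neither of the two values.\<close>
      have ne: "p s' \<noteq> p s" using s permutes_inj[OF p(1)] by (metis injD)
      have "card (T - {p s} - {p s'}) = 1" using 2 fin 3 sT ne by simp
      then obtain c where "T - {p s} - {p s'} = {c}" by (auto simp: card_1_singleton_iff)
      then have c: "c \<in> T" "c \<noteq> p s" "c \<noteq> p s'" by blast+
      define y where "y = inv p c"
      have py: "p y = c" using p(1) by (simp add: y_def permutes_inverses)
      then have "y \<in> B" using c XT p(1) by (metis permutes_in_image subsetD)
      moreover have "y \<notin> X" "s' \<notin> X" using only[of y] only[of s'] py c 2 s by auto
      then have "\<forall>m\<in>M. m s' \<noteq> p y" "\<forall>m\<in>M. m y \<noteq> p s'"
        using col_eq py c 2 ne by metis+
      ultimately show ?thesis using that py c by auto
    qed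
    let ?q = "p \<circ> Transposition.transpose s' y"
    have "?q permutes B" "avoids B M ?q"
      using avoids_swap[OF p s'B(1) y(1)] y by auto
    moreover have "?q s' \<noteq> p s'" using y permutes_inj[OF p(1)] by (auto dest: injD)
    ultimately show ?thesis using s by blast
  qed
qed

text \<open>The four cyclic shifts and one more derangement, chosen so that no two of the five agree on
  three points.\<close>

definition derangement_row :: "nat \<Rightarrow> nat list" where
  "derangement_row a =
     [[2,3,4,5,1], [3,4,5,1,2], [4,5,1,2,3], [5,1,2,3,4], [2,3,5,1,4]] ! a"

definition derangement :: "nat \<Rightarrow> nat \<Rightarrow> nat" where
  "derangement a i = (if i \<in> {1..5} then derangement_row a ! (i - 1) else i)"

lemma atLeastAtMost_1_5: "{1..5::nat} = {1,2,3,4,5}" by auto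
lemma lessThan_5: "{..<5::nat} = {0,1,2,3,4}" by auto

lemma derangement_permutes: "a < 5 \<Longrightarrow> derangement a permutes {1..5}"
proof (rule bij_imp_permutes)
  assume "a < 5"
  then have "a \<in> {0,1,2,3,4}" using lessThan_5 by blast
  then show "bij_betw (derangement a) {1..5} {1..5}"
    unfolding atLeastAtMost_1_5 bij_betw_def
    by (elim insertE emptyE) (auto simp: derangement_def derangement_row_def inj_on_def)
qed (auto simp: derangement_def)

lemma derangement_no_fixpoint: "a < 5 \<Longrightarrow> i \<in> {1..5} \<Longrightarrow> derangement a i \<noteq> i"
proof -
  assume "a < 5" "i \<in> {1..5}"
  then have "a \<in> {0,1,2,3,4}" "i \<in> {1,2,3,4,5}" using lessThan_5 atLeastAtMost_1_5 by blast+
  then show ?thesis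
    by (elim insertE emptyE) (auto simp: derangement_def derangement_row_def)
qed

text \<open>Distinct cyclic shifts agree nowhere. The fifth row agrees with the first one at 1 and
  2, with the second at 3 and 4, with the third nowhere and with the fourth at 5.\<close>

lemma derangement_disagree:
  assumes "a < 5" "b < 5" "a \<noteq> b" "S \<subseteq> {1..5}" "card S = 3"
  shows "\<exists>i\<in>S. derangement a i \<noteq> derangement b i"
proof (rule ccontr)
  assume "\<not> ?thesis"
  then have "S \<subseteq> {i \<in> {1..5}. derangement a i = derangement b i}" using assms by auto
  then have "3 \<le> card {i \<in> {1..5}. derangement a i = derangement b i}"
    using assms(5) card_mono[of "{i \<in> {1..5}. derangement a i = derangement b i}" S] by simp
  moreover have "card {i \<in> {1..5}. derangement a i = derangement b i} \<le> 2"
  proof -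
    have "{i \<in> {1..5}. P i} = set (filter P [1,2,3,4,5])" for P :: "nat \<Rightarrow> bool"
      unfolding atLeastAtMost_1_5 by (simp only: set_filter list.set)
    moreover have "a \<in> {0,1,2,3,4}" "b \<in> {0,1,2,3,4}" using assms lessThan_5 by blast+
    ultimately show ?thesis using assms(3)
      by (elim insertE emptyE) (simp_all add: derangement_def derangement_row_def)
  qed
  ultimately show False by simp
qed

text \<open>Pigeonhole: the five candidates \<open>m \<circ> derangement a\<close> avoid
  \<open>m\<close>, and each of the at most four \<open>v\<close> rejects at most one of them, since
  two candidates rejected by the same \<open>v\<close> would agree on \<open>S v\<close>.\<close>

lemma derangement_choice:
  fixes S :: "'v \<Rightarrow> nat set"
  assumes m: "m permutes {1..5}" and T: "finite T" "card T \<le> 4"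
    and S: "\<And>v. v \<in> T \<Longrightarrow> S v \<subseteq> {1..5} \<and> card (S v) = 3"
    and agree: "\<And>v q q'. v \<in> T \<Longrightarrow> q permutes {1..5} \<Longrightarrow> q' permutes {1..5} \<Longrightarrow> R v q \<Longrightarrow> R v q' \<Longrightarrow>
      \<forall>i\<in>S v. q i = q' i"
  shows "\<exists>q. q permutes {1..5} \<and> avoids {1..5} {m} q \<and> (\<forall>v\<in>T. \<not> R v q)"
proof (rule ccontr)
  assume no: "\<not> ?thesis"
  define q where "q a = m \<circ> derangement a" for a
  have perm: "q a permutes {1..5}" if "a < 5" for a
    using that m derangement_permutes by (simp add: q_def permutes_compose)
  have "avoids {1..5} {m} (q a)" if "a < 5" for a
    using that derangement_no_fixpoint permutes_inj[OF m]
    by (auto simp: q_def avoids_def dest!: injD)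
  then have "\<forall>a\<in>{..<5}. \<exists>v. v \<in> T \<and> R v (q a)" using no perm by blast
  then obtain h where h: "\<And>a. a < 5 \<Longrightarrow> h a \<in> T \<and> R (h a) (q a)"
    by (metis lessThan_iff)
  have "\<not> inj_on h {..<5}"
  proof
    assume "inj_on h {..<5}"
    then have "5 \<le> card T" using card_inj_on_le[of h "{..<5}" T] h T by fastforce
    then show False using T by simp
  qed
  then obtain a b where ab: "a < 5" "b < 5" "a \<noteq> b" "h a = h b" by (auto simp: inj_on_def)
  have "\<forall>i\<in>S (h a). q a i = q b i"
    using h[OF ab(1)] h[OF ab(2)] ab perm by (intro agree) auto
  then have "\<forall>i\<in>S (h a). derangement a i = derangement b i"
    using permutes_inj[OF m] by (auto simp: q_def dest: injD)
  then show False
    using derangement_disagree[OF ab(1-3)] S h ab by metis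
qed

section \<open>Sparse graphs\<close>

definition nbrs :: "'a set set \<Rightarrow> 'a set \<Rightarrow> 'a \<Rightarrow> 'a set" where
  "nbrs E U v = {w \<in> U. {v, w} \<in> E}"

text \<open>The handshake lemma for the subgraph induced by \<open>U\<close>.\<close>

lemma sum_card_nbrs:
  assumes U: "finite U" and E: "\<forall>e\<in>E. card e = 2"
  shows "(\<Sum>v\<in>U. card (nbrs E U v)) = 2 * card {e \<in> E. e \<subseteq> U}"
proof -
  let ?F = "{e \<in> E. e \<subseteq> U}"
  have finF: "finite ?F" using finite_subset[of ?F "Pow U"] U by auto
  have "card (nbrs E U v) = card {e \<in> ?F. v \<in> e}" if v: "v \<in> U" for v
  proof (rule bij_betw_same_card[of "\<lambda>w. {v, w}"])
    have "inj_on (\<lambda>w. {v, w}) (nbrs E U v)" by (auto simp: inj_on_def doubleton_eq_iff)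
    moreover have "(\<lambda>w. {v, w}) ` nbrs E U v = {e \<in> ?F. v \<in> e}"
    proof (intro equalityI subsetI)
      fix e assume e: "e \<in> {e \<in> ?F. v \<in> e}"
      then obtain x y where "e = {x, y}" using E by (metis (no_types, lifting) card_2_iff mem_Collect_eq)
      then obtain w where "e = {v, w}" using e by auto
      then show "e \<in> (\<lambda>w. {v, w}) ` nbrs E U v" using e by (auto simp: nbrs_def)
    qed (use v in \<open>auto simp: nbrs_def\<close>)
    ultimately show "bij_betw (\<lambda>w. {v, w}) (nbrs E U v) {e \<in> ?F. v \<in> e}"
      by (simp add: bij_betw_def)
  qed
  then have "(\<Sum>v\<in>U. card (nbrs E U v)) = (\<Sum>v\<in>U. card {e \<in> ?F. v \<in> e})" by simp
  also have "\<dots> = (\<Sum>e\<in>?F. card {v \<in> U. v \<in> e})"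
    using U finF by (intro sum_multicount_gen) auto
  also have "\<dots> = (\<Sum>e\<in>?F. 2)"
  proof (rule sum.cong)
    fix e assume "e \<in> ?F"
    then have "{v \<in> U. v \<in> e} = e" "card e = 2" using E by auto
    then show "card {v \<in> U. v \<in> e} = 2" by simp
  qed simp
  finally show ?thesis by simp
qed

text \<open>Discharging: every vertex of degree three takes \<open>1/3\<close> from each of its neighbours.\<close>

lemma reducible_configuration:
  assumes U: "finite U" and E: "\<forall>e\<in>E. card e = 2"
    and sparse: "card {e \<in> E. e \<subseteq> U} < 2 * card U"
  obtains (low) v where "v \<in> U" "card (nbrs E U v) \<le> 2"
  | (pair) v w where "v \<in> U" "w \<in> nbrs E U v" "card (nbrs E U v) \<le> 3" "card (nbrs E U w) \<le> 4"
  | (star) w T where "w \<in> U" "T \<subseteq> nbrs E U w" "card T = 4" "card (nbrs E U w) \<le> 5"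
      "\<forall>v\<in>T. card (nbrs E U v) \<le> 3" "\<forall>v\<in>T. \<forall>v'\<in>T. {v, v'} \<notin> E"
proof (rule ccontr)
  assume no: "\<not> thesis"
  define d where "d v = card (nbrs E U v)" for v
  define A where "A = {v \<in> U. d v = 3}"
  have d3: "3 \<le> d v" if "v \<in> U" for v using low[of v] that no by (fastforce simp: d_def)
  have adj: "5 \<le> d w" if "v \<in> A" "w \<in> nbrs E U v" for v w
    using pair[of v w] that no by (fastforce simp: d_def A_def)
  have finN: "finite (nbrs E U v)" for v using U by (auto simp: nbrs_def)
  have sym: "w \<in> nbrs E U v \<longleftrightarrow> v \<in> nbrs E U w" if "v \<in> U" "w \<in> U" for v w
    using that by (auto simp: nbrs_def insert_commute)
  have finA: "finite A" and AU: "A \<subseteq> U" using U by (auto simp: A_def)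
  \<comment> \<open>Charges are tripled to stay in the natural numbers: a vertex outside
    \<open>A\<close> must keep 12 after giving one unit to each neighbour in \<open>A\<close>.
    Degree four has no such neighbour (else \<open>pair\<close>), degree five at most three (else
    \<open>star\<close>), and from degree six on \<open>3 * d w - d w\<close> suffices.\<close>
  have charge: "12 + card {v \<in> A. v \<in> nbrs E U w} \<le> 3 * d w" if w: "w \<in> U - A" for w
  proof -
    let ?K = "{v \<in> A. v \<in> nbrs E U w}"
    have le: "card ?K \<le> d w" unfolding d_def by (intro card_mono finN) auto
    have dw: "d w \<ge> 4" using d3[of w] w by (fastforce simp: A_def)
    show ?thesis
    proof (cases "?K = {}")
      case False
      then obtain v where v: "v \<in> A" "v \<in> nbrs E U w" by blast
      then have d5: "d w \<ge> 5" using adj[of v w] sym[of v w] AU w by auto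
      have "card ?K \<le> 3" if "d w = 5"
      proof (rule ccontr)
        assume "\<not> card ?K \<le> 3"
        then have "4 \<le> card ?K" by simp
        then obtain T where T: "T \<subseteq> ?K" "card T = 4" using obtain_subset_with_card_n by metis
        \<comment> \<open>Two adjacent vertices of degree three would already be a
          \<open>pair\<close>.\<close>
        have "{v, v'} \<notin> E" if "v \<in> T" "v' \<in> T" for v v'
        proof
          assume "{v, v'} \<in> E"
          moreover have "v \<in> A" "v' \<in> A" using that T by auto
          ultimately have "5 \<le> d v'" using adj[of v v'] AU by (auto simp: nbrs_def)
          then show False using \<open>v' \<in> A\<close> by (simp add: A_def)
        qed
        moreover have "\<forall>v\<in>T. card (nbrs E U v) \<le> 3" using T by (auto simp: A_def d_def)
        ultimately have thesis using star[of w T] w T that by (auto simp: d_def)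
        then show False using no by simp
      qed
      then show ?thesis using d5 le by (cases "d w = 5") auto
    next
      case True
      then have "card ?K = 0" by (simp only: card.empty)
      then show ?thesis using dw by linarith
    qed
  qed
  \<comment> \<open>All three neighbours of a vertex in \<open>A\<close> lie outside
    \<open>A\<close>, so each such vertex receives exactly three units and ends with
    \<open>9 + 3 = 12\<close> as well.\<close>
  have "3 * card A = (\<Sum>v\<in>A. card {w \<in> U - A. v \<in> nbrs E U w})"
  proof -
    have "card {w \<in> U - A. v \<in> nbrs E U w} = 3" if v: "v \<in> A" for v
    proof -
      have "{w \<in> U - A. v \<in> nbrs E U w} = nbrs E U v"
      proof (intro equalityI subsetI)
        fix w assume "w \<in> {w \<in> U - A. v \<in> nbrs E U w}"
        then show "w \<in> nbrs E U v" using sym[of v w] AU v by auto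
      next
        fix w assume w: "w \<in> nbrs E U v"
        then have "w \<in> U" by (simp add: nbrs_def)
        moreover have "w \<notin> A" using adj[OF v w] by (auto simp: A_def)
        ultimately show "w \<in> {w \<in> U - A. v \<in> nbrs E U w}" using w sym[of v w] AU v by auto
      qed
      then show ?thesis using v by (simp add: A_def d_def)
    qed
    then show ?thesis by simp
  qed
  also have "\<dots> = (\<Sum>w\<in>U - A. card {v \<in> A. v \<in> nbrs E U w})"
    using U finA by (intro sum_multicount_gen) auto
  finally have "12 * card (U - A) + 3 * card A = (\<Sum>w\<in>U - A. 12 + card {v \<in> A. v \<in> nbrs E U w})"
    by (simp add: sum.distrib)
  also have "\<dots> \<le> (\<Sum>w\<in>U - A. 3 * d w)" using charge by (intro sum_mono) auto
  finally have 1: "12 * card (U - A) + 3 * card A \<le> 3 * (\<Sum>w\<in>U - A. d w)"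
    by (simp add: sum_distrib_left)
  have "(\<Sum>w\<in>U. d w) = (\<Sum>w\<in>U - A. d w) + (\<Sum>w\<in>A. d w)"
    using U AU by (simp add: sum.subset_diff)
  also have "(\<Sum>w\<in>A. d w) = 3 * card A" by (simp add: A_def)
  finally have 2: "(\<Sum>w\<in>U. d w) = (\<Sum>w\<in>U - A. d w) + 3 * card A" .
  have 3: "card U = card (U - A) + card A" using U AU finA by (simp add: card_Diff_subset card_mono)
  have "(\<Sum>w\<in>U. d w) < 4 * card U"
    unfolding d_def using sum_card_nbrs[OF U E] sparse by simp
  then show False using 1 2 3 by linarith
qed

section \<open>Extending and recolouring partial packings\<close>

text \<open>Every edge carries mutually inverse permutations in its two directions, so the
  orientation of the cover can be forgotten.\<close>

locale five_cover =
  fixes E :: "'a set set" and c :: "'a \<Rightarrow> 'a \<Rightarrow> nat \<Rightarrow> nat"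
  assumes card_edge: "e \<in> E \<Longrightarrow> card e = 2"
    and transport_permutes: "{v, w} \<in> E \<Longrightarrow> c v w permutes {1..5}"
    and transport_inv: "{v, w} \<in> E \<Longrightarrow> c w v = inv (c v w)"
begin

abbreviation B :: "nat set" where "B \<equiv> {1..5}"

text \<open>A packing is encoded by the permutations \<open>P v\<close> sending \<open>i\<close> to the colour of \<open>v\<close> in the
  \<open>i\<close>-th colouring.\<close>

definition good :: "'a set \<Rightarrow> ('a \<Rightarrow> nat \<Rightarrow> nat) \<Rightarrow> bool" where
  "good U P \<longleftrightarrow> (\<forall>v\<in>U. P v permutes B) \<and>
     (\<forall>v\<in>U. \<forall>w\<in>U. {v, w} \<in> E \<longrightarrow> (\<forall>i\<in>B. c v w (P v i) \<noteq> P w i))"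

text \<open>A permutation at \<open>v\<close> is compatible with \<open>P\<close> on
  \<open>W\<close> exactly if it avoids these, for \<open>W\<close> consisting of neighbours of
  \<open>v\<close>; this is the link to the problem of avoiding permutations.\<close>

definition forbidden :: "('a \<Rightarrow> nat \<Rightarrow> nat) \<Rightarrow> 'a set \<Rightarrow> 'a \<Rightarrow> (nat \<Rightarrow> nat) set" where
  "forbidden P W v = (\<lambda>w. c w v \<circ> P w) ` W"

lemma no_loop: "{v, v} \<notin> E"
  using card_edge[of "{v, v}"] by auto

lemma transport_swap:
  assumes "{v, w} \<in> E"
  shows "c v w x \<noteq> y \<longleftrightarrow> c w v y \<noteq> x"
  using transport_inv[OF assms] transport_permutes[OF assms]
  by (metis permutes_inverses(1,2))

lemma forbidden_permutes:
  assumes "good U P" "W \<subseteq> nbrs E U v"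
  shows "\<forall>m\<in>forbidden P W v. m permutes B"
proof
  fix m assume "m \<in> forbidden P W v"
  then obtain w where "w \<in> W" "m = c w v \<circ> P w" by (auto simp: forbidden_def)
  moreover from this have "{w, v} \<in> E" "w \<in> U" using assms(2) by (auto simp: nbrs_def insert_commute)
  ultimately show "m permutes B"
    using assms(1) transport_permutes by (auto simp: good_def intro!: permutes_compose)
qed

lemma card_forbidden: "finite W \<Longrightarrow> finite (forbidden P W v) \<and> card (forbidden P W v) \<le> card W"
  by (auto simp: forbidden_def card_image_le)

lemma good_avoids:
  assumes "good U P" "v \<in> U" "W \<subseteq> nbrs E U v"
  shows "avoids B (forbidden P W v) (P v)"
  using assms by (fastforce simp: good_def avoids_def forbidden_def nbrs_def insert_commute)

text \<open>The vertices of an independent set put no constraint on each other, so they can be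
  coloured separately.\<close>

lemma good_extend:
  assumes P: "good (U - T) P" and ind: "\<forall>v\<in>T. \<forall>v'\<in>T. {v, v'} \<notin> E"
    and ext: "\<forall>v\<in>T. \<not> blocked B (forbidden P (nbrs E (U - T) v) v)"
  shows "\<exists>P'. good U P'"
proof -
  obtain r where r: "\<And>v. v \<in> T \<Longrightarrow> r v permutes B \<and> avoids B (forbidden P (nbrs E (U - T) v) v) (r v)"
    using ext unfolding blocked_def by metis
  define P' where "P' x = (if x \<in> T then r x else P x)" for x
  have new: "c w v (P w i) \<noteq> r v i" if "v \<in> T" "w \<in> U - T" "{w, v} \<in> E" "i \<in> B" for v w i
  proof -
    have "c w v \<circ> P w \<in> forbidden P (nbrs E (U - T) v) v"
      using that by (auto simp: forbidden_def nbrs_def insert_commute)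
    then have "r v i \<noteq> (c w v \<circ> P w) i"
      using r[OF that(1)] that(4) unfolding avoids_def by blast
    then show ?thesis by simp
  qed
  have "c v w (P' v i) \<noteq> P' w i" if vw: "v \<in> U" "w \<in> U" "{v, w} \<in> E" "i \<in> B" for v w i
  proof -
    consider "v \<notin> T" "w \<notin> T" | "v \<in> T" "w \<notin> T" | "v \<notin> T" "w \<in> T"
      using ind vw by blast
    then show ?thesis
    proof cases
      case 1
      then show ?thesis using P vw by (auto simp: good_def P'_def)
    next
      case 2
      have wv: "{w, v} \<in> E" using vw by (simp add: insert_commute)
      have "c w v (P w i) \<noteq> r v i" using new[of v w i] 2 vw wv by blast
      then show ?thesis using 2 transport_swap[OF wv] by (simp add: P'_def)
    next
      case 3
      then show ?thesis using new[of w v i] vw by (simp add: P'_def)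
    qed
  qed
  moreover have "P' v permutes B" if "v \<in> U" for v
    using that r P by (auto simp: P'_def good_def)
  ultimately have "good U P'" unfolding good_def by blast
  then show ?thesis by blast
qed

lemma good_update:
  assumes P: "good U P" and q: "q permutes B" "avoids B (forbidden P (nbrs E U w) w) q"
  shows "good U (P(w := q))"
proof -
  have new: "c v w (P v i) \<noteq> q i" if "v \<in> U" "{v, w} \<in> E" "i \<in> B" for v i
  proof -
    have "c v w \<circ> P v \<in> forbidden P (nbrs E U w) w"
      using that by (auto simp: forbidden_def nbrs_def insert_commute)
    then have "q i \<noteq> (c v w \<circ> P v) i" using q(2) that(3) unfolding avoids_def by blast
    then show ?thesis by simp
  qed
  have "c v x ((P(w := q)) v i) \<noteq> (P(w := q)) x i"
    if vx: "v \<in> U" "x \<in> U" "{v, x} \<in> E" "i \<in> B" for v x i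
  proof -
    have "v \<noteq> x" using no_loop vx by auto
    moreover have xv: "{x, v} \<in> E" using vx by (simp add: insert_commute)
    ultimately consider "v \<noteq> w" "x \<noteq> w" | "v \<noteq> w" "x = w" | "v = w" "x \<noteq> w" by blast
    then show ?thesis
    proof cases
      case 1
      then show ?thesis using P vx by (auto simp: good_def)
    next
      case 2
      then show ?thesis using new[of v i] vx by simp
    next
      case 3
      then have "c x v (P x i) \<noteq> q i" using new[of x i] vx xv by simp
      then show ?thesis using 3 transport_swap[OF xv] by simp
    qed
  qed
  then show ?thesis using P q(1) by (auto simp: good_def)
qed

text \<open>After \<open>w\<close> is recoloured by \<open>q\<close>, the permutations forbidden at
  \<open>v\<close> in \<open>T\<close> are one new one coming from \<open>w\<close> and the old ones
  from the other neighbours.\<close>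

lemma good_recolour_extend:
  assumes P: "good (U - T) P" and w: "w \<in> U" "T \<subseteq> nbrs E U w"
    and ind: "\<forall>v\<in>T. \<forall>v'\<in>T. {v, v'} \<notin> E"
    and q: "q permutes B" "avoids B (forbidden P (nbrs E (U - T) w) w) q"
    and ext: "\<forall>v\<in>T. \<not> blocked B (insert (c w v \<circ> q) (forbidden P (nbrs E (U - T) v - {w}) v))"
  shows "\<exists>P'. good U P'"
proof (rule good_extend[OF good_update[OF P q] ind], rule ballI)
  fix v assume v: "v \<in> T"
  have "w \<notin> T" using w no_loop by (auto simp: nbrs_def)
  let ?K = "nbrs E (U - T) v - {w}"
  have "nbrs E (U - T) v = insert w ?K"
    using w v \<open>w \<notin> T\<close> by (auto simp: nbrs_def insert_commute)
  moreover have "forbidden (P(w := q)) (insert w ?K) v = insert (c w v \<circ> q) (forbidden (P(w := q)) ?K v)"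
    unfolding forbidden_def image_insert by (simp only: fun_upd_same)
  moreover have "forbidden (P(w := q)) ?K v = forbidden P ?K v"
    unfolding forbidden_def by (intro image_cong) auto
  ultimately have "forbidden (P(w := q)) (nbrs E (U - T) v) v = insert (c w v \<circ> q) (forbidden P ?K v)"
    by metis
  then show "\<not> blocked B (forbidden (P(w := q)) (nbrs E (U - T) v) v)"
    using ext v by simp
qed

text \<open>One of the at most three neighbours of \<open>v\<close> is \<open>w\<close>, so the
  others supply the set \<open>N\<close> of at most two permutations for
  \<open>blocking_agree\<close>.\<close>

lemma outer_forbidden:
  assumes U: "finite U" and P: "good (U - T) P" and w: "w \<in> U" "T \<subseteq> nbrs E U w" and v: "v \<in> T"
    and deg: "card (nbrs E U v) \<le> 3"
  shows "finite (forbidden P (nbrs E (U - T) v - {w}) v)"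
    "card (forbidden P (nbrs E (U - T) v - {w}) v) \<le> 2"
    "\<forall>m\<in>forbidden P (nbrs E (U - T) v - {w}) v. m permutes B"
proof -
  have fin: "finite (nbrs E U v)" using U by (auto simp: nbrs_def)
  have "w \<in> nbrs E U v" using w v by (auto simp: nbrs_def insert_commute)
  moreover have "nbrs E (U - T) v - {w} \<subseteq> nbrs E U v - {w}" by (auto simp: nbrs_def)
  then have "card (nbrs E (U - T) v - {w}) \<le> card (nbrs E U v - {w})"
    using fin by (intro card_mono) auto
  ultimately have "card (nbrs E (U - T) v - {w}) \<le> 2" using deg fin by simp
  moreover have "finite (nbrs E (U - T) v - {w})" using U by (auto simp: nbrs_def)
  ultimately show "finite (forbidden P (nbrs E (U - T) v - {w}) v)"
    "card (forbidden P (nbrs E (U - T) v - {w}) v) \<le> 2"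
    using card_forbidden le_trans by blast+
  show "\<forall>m\<in>forbidden P (nbrs E (U - T) v - {w}) v. m permutes B"
    by (rule forbidden_permutes[OF P]) auto
qed

lemma good_low:
  assumes U: "finite U" and v: "v \<in> U" "card (nbrs E U v) \<le> 2" and P: "good (U - {v}) P"
  shows "\<exists>P'. good U P'"
proof (rule good_extend[OF P])
  show "\<forall>x\<in>{v}. \<forall>x'\<in>{v}. {x, x'} \<notin> E" using no_loop by simp
  have fin: "finite (nbrs E (U - {v}) v)" "finite (nbrs E U v)" using U by (auto simp: nbrs_def)
  have "card (nbrs E (U - {v}) v) \<le> card (nbrs E U v)"
    using fin by (intro card_mono) (auto simp: nbrs_def)
  then have "\<not> blocked B (forbidden P (nbrs E (U - {v}) v) v)"
    using card_forbidden[OF fin(1), of P v] v forbidden_permutes[OF P order_refl, of v]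
    by (intro not_blocked_two) auto
  then show "\<forall>x\<in>{v}. \<not> blocked B (forbidden P (nbrs E (U - {v}) x) x)" by simp
qed

text \<open>Without \<open>v\<close>, the vertex \<open>w\<close> has at most three neighbours, so
  \<open>avoids_change_on\<close> can recolour it. If \<open>P w\<close> blocks \<open>v\<close>,
  then all blocking choices agree with \<open>P w\<close> on \<open>S\<close>, and a change inside
  \<open>S\<close> unblocks \<open>v\<close>.\<close>

lemma good_pair:
  assumes U: "finite U" and v: "v \<in> U" "w \<in> nbrs E U v"
    and deg: "card (nbrs E U v) \<le> 3" "card (nbrs E U w) \<le> 4" and P: "good (U - {v}) P"
  shows "\<exists>P'. good U P'"
proof -
  have wv: "{w, v} \<in> E" "w \<in> U - {v}" "v \<in> nbrs E U w"
    using v no_loop by (auto simp: nbrs_def insert_commute)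
  let ?M = "forbidden P (nbrs E (U - {v}) w) w" and ?N = "forbidden P (nbrs E (U - {v}) v - {w}) v"
  have fin: "finite (nbrs E (U - {v}) w)" "finite (nbrs E U w)" using U by (auto simp: nbrs_def)
  have "nbrs E (U - {v}) w = nbrs E U w - {v}" by (auto simp: nbrs_def)
  then have "card (nbrs E (U - {v}) w) \<le> 3" using deg wv fin by simp
  then have M: "finite ?M" "card ?M \<le> 3" "\<forall>m\<in>?M. m permutes B"
    using card_forbidden[OF fin(1), of P w] forbidden_permutes[OF P order_refl, of w] by auto
  have "\<exists>q. q permutes B \<and> avoids B ?M q \<and> \<not> blocked B (insert (c w v \<circ> q) ?N)"
  proof (cases "blocked B (insert (c w v \<circ> P w) ?N)")
    case False
    then show ?thesis using good_avoids[OF P wv(2) order_refl] P wv by (auto simp: good_def)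
  next
    case True
    have Pw: "P w permutes B" "avoids B ?M (P w)"
      using good_avoids[OF P wv(2) order_refl] P wv by (auto simp: good_def)
    have N: "finite ?N" "card ?N \<le> 2" "\<forall>m\<in>?N. m permutes B"
      using outer_forbidden[OF U P, of w v] wv deg by auto
    obtain S where S: "S \<subseteq> B" "card S = 3"
      "\<And>q q'. q permutes B \<Longrightarrow> q' permutes B \<Longrightarrow> blocked B (insert (c w v \<circ> q) ?N) \<Longrightarrow>
         blocked B (insert (c w v \<circ> q') ?N) \<Longrightarrow> \<forall>i\<in>S. q i = q' i"
      using blocking_agree[OF _ _ N transport_permutes[OF wv(1)]] by auto
    obtain q where "q permutes B" "avoids B ?M q" "\<exists>i\<in>S. q i \<noteq> P w i"
      using avoids_change_on[OF _ _ M Pw S(1,2)] by auto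
    then show ?thesis using S(3)[of q "P w"] Pw True by blast
  qed
  then obtain q where "q permutes B" "avoids B ?M q" "\<not> blocked B (insert (c w v \<circ> q) ?N)" by blast
  then show ?thesis
    using wv no_loop by (intro good_recolour_extend[OF P, of w q]) auto
qed

text \<open>Outside \<open>T\<close> the vertex \<open>w\<close> has at most one neighbour, hence at
  most one permutation to avoid, and each of the four members of \<open>T\<close> excludes only
  choices that agree on three indices; \<open>derangement_choice\<close> satisfies all at
  once.\<close>

lemma good_star:
  assumes U: "finite U" and w: "w \<in> U" "T \<subseteq> nbrs E U w" "card T = 4" "card (nbrs E U w) \<le> 5"
    and deg: "\<forall>v\<in>T. card (nbrs E U v) \<le> 3" and ind: "\<forall>v\<in>T. \<forall>v'\<in>T. {v, v'} \<notin> E"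
    and P: "good (U - T) P"
  shows "\<exists>P'. good U P'"
proof -
  have fin: "finite (nbrs E U w)" "finite (nbrs E (U - T) w)" using U by (auto simp: nbrs_def)
  have finT: "finite T" using w fin finite_subset by blast
  let ?M = "forbidden P (nbrs E (U - T) w) w"
  let ?R = "\<lambda>v q. blocked B (insert (c w v \<circ> q) (forbidden P (nbrs E (U - T) v - {w}) v))"
  have "nbrs E (U - T) w = nbrs E U w - T" by (auto simp: nbrs_def)
  then have "card (nbrs E (U - T) w) \<le> 1" using w finT by (simp add: card_Diff_subset)
  then have "card ?M \<le> 1" "finite ?M" using card_forbidden[OF fin(2), of P w] by auto
  moreover have "\<forall>m\<in>?M. m permutes B" by (rule forbidden_permutes[OF P order_refl])
  ultimately have "\<exists>m. m permutes B \<and> ?M \<subseteq> {m}"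
  proof (cases "?M = {}")
    case True
    \<comment> \<open>Without a neighbour outside \<open>T\<close>, the identity serves as a
      placeholder for \<open>m\<close>.\<close>
    then show ?thesis using permutes_id[of B] by (metis empty_subsetI)
  next
    case False
    then obtain m where m: "m \<in> ?M" by blast
    then have "?M \<subseteq> {m}"
      using \<open>card ?M \<le> 1\<close> \<open>finite ?M\<close> by (metis One_nat_def card_le_Suc0_iff_eq insertI1 subsetI)
    then show ?thesis using m \<open>\<forall>m\<in>?M. m permutes B\<close> by blast
  qed
  then obtain m where m: "m permutes B" "?M \<subseteq> {m}" by blast
  have "\<exists>S. S \<subseteq> B \<and> card S = 3 \<and>
      (\<forall>q q'. q permutes B \<longrightarrow> q' permutes B \<longrightarrow> ?R v q \<longrightarrow> ?R v q' \<longrightarrow> (\<forall>i\<in>S. q i = q' i))"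
    if v: "v \<in> T" for v
  proof -
    have "{w, v} \<in> E" using w v by (auto simp: nbrs_def)
    then obtain S where "S \<subseteq> B" "card S = 3"
      "\<And>q q'. q permutes B \<Longrightarrow> q' permutes B \<Longrightarrow> ?R v q \<Longrightarrow> ?R v q' \<Longrightarrow> \<forall>i\<in>S. q i = q' i"
      using blocking_agree[OF _ _ outer_forbidden[OF U P w(1,2) v] transport_permutes] deg v by auto
    then show ?thesis by blast
  qed
  then obtain S where S: "\<And>v. v \<in> T \<Longrightarrow> S v \<subseteq> B \<and> card (S v) = 3 \<and>
      (\<forall>q q'. q permutes B \<longrightarrow> q' permutes B \<longrightarrow> ?R v q \<longrightarrow> ?R v q' \<longrightarrow> (\<forall>i\<in>S v. q i = q' i))"
    by metis
  have "\<exists>q. q permutes B \<and> avoids B {m} q \<and> (\<forall>v\<in>T. \<not> ?R v q)"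
    using S w finT by (intro derangement_choice[OF m(1), where S = S]) auto
  then obtain q where q: "q permutes B" "avoids B {m} q" "\<forall>v\<in>T. \<not> ?R v q" by blast
  have "avoids B ?M q" using q(2) m(2) by (auto simp: avoids_def)
  then show ?thesis using good_recolour_extend[OF P w(1,2) ind q(1) _ q(3)] by blast
qed

lemma good_exists:
  assumes "finite U" "\<And>W. W \<subseteq> U \<Longrightarrow> W \<noteq> {} \<Longrightarrow> card {e \<in> E. e \<subseteq> W} < 2 * card W"
  shows "\<exists>P. good U P"
  using assms
proof (induction U rule: finite_psubset_induct)
  case (psubset U)
  show ?case
  proof (cases "U = {}")
    case True
    then show ?thesis by (simp add: good_def)
  next
    case False
    \<comment> \<open>Sparsity passes to subsets of \<open>U\<close>, so a packing exists after any
      nonempty set of vertices is deleted.\<close>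
    have IH: "\<exists>P. good (U - T) P" if "T \<noteq> {}" "T \<subseteq> U" for T
      using that by (intro psubset.IH psubset.prems) auto
    have sparse: "card {e \<in> E. e \<subseteq> U} < 2 * card U" using psubset.prems False by blast
    have edges: "\<forall>e\<in>E. card e = 2" using card_edge by blast
    show ?thesis
    proof (cases rule: reducible_configuration[OF psubset.hyps(1) edges sparse, case_names low pair star])
      case (low v)
      then show ?thesis using good_low[OF psubset.hyps] IH[of "{v}"] by blast
    next
      case (pair v w)
      then show ?thesis using good_pair[OF psubset.hyps] IH[of "{v}"] by blast
    next
      case (star w T)
      then have "T \<noteq> {}" "T \<subseteq> U" by (auto simp: nbrs_def)
      then obtain P where "good (U - T) P" using IH by blast
      then show ?thesis using good_star[OF psubset.hyps star] by blast
    qed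
  qed
qed

end

section \<open>From edge bounds to the packing number\<close>

lemma is_packing_exists:
  assumes G: "fin_simple_graph V E"
    and sparse: "\<And>W. W \<subseteq> V \<Longrightarrow> W \<noteq> {} \<Longrightarrow> card {e \<in> E. e \<subseteq> W} < 2 * card W"
    and cover: "is_cover 5 E D \<sigma>"
  shows "\<exists>\<phi>. is_packing 5 V D \<sigma> \<phi>"
proof -
  \<comment> \<open>Exactly one direction of each edge is an arc; against the arc the inverse
    permutation is used.\<close>
  define c where "c v w = (if (v, w) \<in> D then \<sigma> (v, w) else inv (\<sigma> (w, v)))" for v w
  have orient: "(v, w) \<in> D \<longleftrightarrow> (w, v) \<notin> D" if "{v, w} \<in> E" for v w
    using cover that by (auto simp: is_cover_def is_orientation_def)
  have perm: "\<sigma> a permutes {1..5}" if "a \<in> D" for a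
    using cover that by (auto simp: is_cover_def)
  interpret five_cover E c
  proof
    show "card e = 2" if "e \<in> E" for e using G that by (auto simp: fin_simple_graph_def)
    fix v w assume vw: "{v, w} \<in> E"
    show "c v w permutes {1..5}"
      using orient[OF vw] perm[of "(v, w)"] perm[of "(w, v)"] by (auto simp: c_def permutes_inv)
    show "c w v = inv (c v w)"
      using orient[OF vw] perm[of "(w, v)"] by (auto simp: c_def permutes_inv_inv)
  qed
  have "finite V" using G by (simp add: fin_simple_graph_def)
  then obtain P where P: "good V P" using good_exists sparse by blast
  have "is_packing 5 V D \<sigma> (\<lambda>i v. P v i)"
    unfolding is_packing_def is_coloring_def
  proof (intro conjI ballI allI impI)
    fix i :: nat assume i: "i \<in> {1..5}"
    show "(\<lambda>v. P v i) \<in> V \<rightarrow> {1..5}"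
      using P i by (auto simp: good_def permutes_in_image simp del: atLeastAtMost_iff)
    fix v w assume vw: "(v, w) \<in> D"
    then have "{v, w} \<in> E" using cover by (auto simp: is_cover_def is_orientation_def)
    moreover from this have "v \<in> V" "w \<in> V" using G by (auto simp: fin_simple_graph_def)
    ultimately have "c v w (P v i) \<noteq> P w i" using P i unfolding good_def by blast
    then show "\<sigma> (v, w) (P v i) \<noteq> P w i" using vw by (simp add: c_def)
  next
    fix v i j assume "v \<in> V" "i \<noteq> (j::nat)"
    then show "P v i \<noteq> P v j" using P by (metis good_def injD permutes_inj)
  qed
  then show ?thesis by blast
qed

lemma corr_packing_number_le_5:
  assumes G: "fin_simple_graph V E"
    and sparse: "\<And>W. W \<subseteq> V \<Longrightarrow> W \<noteq> {} \<Longrightarrow> card {e \<in> E. e \<subseteq> W} < 2 * card W"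
  shows "corr_packing_number V E \<le> 5"
proof -
  have "corr_packing_number V E \<le> enat 5"
    unfolding corr_packing_number_def
    using is_packing_exists[OF assms] by (intro INF_lower) auto
  then show ?thesis by (simp add: numeral_eq_enat)
qed

lemma max_avg_degree_sparse:
  assumes G: "fin_simple_graph V E" and mad: "max_avg_degree V E < 4"
    and W: "W \<subseteq> V" "W \<noteq> {}"
  shows "card {e \<in> E. e \<subseteq> W} < 2 * card W"
proof -
  let ?A = "{2 * real (card F) / real (card W) | W F. is_subgraph W F V E \<and> W \<noteq> {}}"
  have fin: "finite V" "finite E"
    using G finite_subset[of E "Pow V"] by (auto simp: fin_simple_graph_def)
  \<comment> \<open>Finiteness of the set of ratios has to be shown before its \<open>Max\<close>
    bounds the ratio of the subgraph induced by \<open>W\<close>.\<close>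
  have "?A \<subseteq> (\<lambda>(W, F). 2 * real (card F) / real (card W)) ` (Pow V \<times> Pow E)"
    by (auto simp: is_subgraph_def)
  then have "finite ?A" using fin by (meson finite_Pow_iff finite_SigmaI finite_imageI finite_subset)
  moreover have "2 * real (card {e \<in> E. e \<subseteq> W}) / real (card W) \<in> ?A"
    using W by (force simp: is_subgraph_def)
  ultimately have "2 * real (card {e \<in> E. e \<subseteq> W}) / real (card W) < 4"
    using mad unfolding max_avg_degree_def by (meson Max_ge le_less_trans)
  moreover have "card W > 0" using W fin finite_subset by (metis card_gt_0_iff)
  ultimately show ?thesis by (simp add: field_simps)
qed

section \<open>Plane graphs\<close>

text \<open>Otherwise a nonempty open subset of the plane would embed into the real line, against
  invariance of dimension.\<close>

lemma interior_arc_image: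
  fixes g :: "real \<Rightarrow> complex"
  assumes "arc g"
  shows "interior (path_image g) = {}"
proof (rule ccontr)
  assume ne: "interior (path_image g) \<noteq> {}"
  have "path_image g homeomorphic {0..1::real}"
    using assms homeomorphic_arc_image_interval zero_less_one by blast
  then obtain f h where "homeomorphism (path_image g) {0..1::real} f h"
    by (auto simp: homeomorphic_def)
  then have "continuous_on (path_image g) f" "inj_on f (path_image g)"
    by (auto simp: homeomorphism_def intro: inj_on_inverseI)
  then have "continuous_on (interior (path_image g)) f" "inj_on f (interior (path_image g))"
    using interior_subset continuous_on_subset inj_on_subset by blast+
  then have "DIM(complex) \<le> DIM(real)"
    using ne invariance_of_dimension by blast
  then show False by simp
qed

lemma connected_subset_singleton: "S \<subseteq> {x} \<Longrightarrow> connected S"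
  by (metis connected_empty connected_sing subset_singletonD)

locale plane_graph =
  fixes V :: "'a set" and E :: "'a set set"
    and pt :: "'a \<Rightarrow> complex" and \<gamma> :: "'a set \<Rightarrow> real \<Rightarrow> complex"
  assumes graph: "fin_simple_graph V E" and drawing: "plane_drawing V E pt \<gamma>"
begin

abbreviation arc_of :: "'a set \<Rightarrow> complex set" where
  "arc_of e \<equiv> path_image (\<gamma> e)"

text \<open>Faces are the components of \<open>- drawn F\<close> and are represented below by sample
  points; vertices on no edge of \<open>F\<close> are left out of this set.\<close>

definition drawn :: "'a set set \<Rightarrow> complex set" where
  "drawn F = (\<Union>e\<in>F. arc_of e)"

lemma finite_E: "finite E"
proof -
  have "E \<subseteq> Pow V" using graph by (auto simp: fin_simple_graph_def)
  then show ?thesis using graph finite_subset by (auto simp: fin_simple_graph_def)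
qed

lemma edge_subset: "e \<in> E \<Longrightarrow> e \<subseteq> V"
  and card_edge: "e \<in> E \<Longrightarrow> card e = 2"
  using graph by (auto simp: fin_simple_graph_def)

lemma arc_edge: "e \<in> E \<Longrightarrow> arc (\<gamma> e)"
  and ends_edge: "e \<in> E \<Longrightarrow> {pathstart (\<gamma> e), pathfinish (\<gamma> e)} = pt ` e"
  and vertices_on_edge: "e \<in> E \<Longrightarrow> arc_of e \<inter> pt ` V = pt ` e"
  and edge_Int_edge: "e \<in> E \<Longrightarrow> f \<in> E \<Longrightarrow> e \<noteq> f \<Longrightarrow> arc_of e \<inter> arc_of f = pt ` (e \<inter> f)"
  and inj_pt: "inj_on pt V"
  using drawing by (auto simp: plane_drawing_def)

lemma pt_in_edge_iff: "e \<in> E \<Longrightarrow> x \<in> V \<Longrightarrow> pt x \<in> arc_of e \<longleftrightarrow> x \<in> e"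
  using vertices_on_edge[of e] inj_pt edge_subset[of e] by (auto simp: inj_on_def)

lemma drawn_Un: "drawn (F \<union> F') = drawn F \<union> drawn F'"
  and drawn_mono: "F \<subseteq> F' \<Longrightarrow> drawn F \<subseteq> drawn F'"
  and drawn_empty [simp]: "drawn {} = {}"
  and drawn_insert: "drawn (insert e F) = arc_of e \<union> drawn F"
  by (auto simp: drawn_def)

lemma drawn_remove: "e \<in> F \<Longrightarrow> drawn F = arc_of e \<union> drawn (F - {e})"
  by (auto simp: drawn_def)

lemma compact_drawn: "F \<subseteq> E \<Longrightarrow> compact (drawn F)"
  unfolding drawn_def using finite_subset[OF _ finite_E] arc_edge
  by (intro compact_UN) (auto simp: compact_arc_image)

lemma closed_drawn: "F \<subseteq> E \<Longrightarrow> closed (drawn F)"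
  by (simp add: compact_drawn compact_imp_closed)

lemma open_Compl_drawn: "F \<subseteq> E \<Longrightarrow> open (- drawn F)"
  using closed_drawn by blast

lemma interior_drawn: "F \<subseteq> E \<Longrightarrow> interior (drawn F) = {}"
proof -
  assume F: "F \<subseteq> E"
  then have "finite F" using finite_E finite_subset by blast
  then show ?thesis using F
  proof induction
    case empty then show ?case by simp
  next
    case (insert e F)
    have "interior (drawn (insert e F)) = interior (arc_of e)"
      unfolding drawn_insert
      by (rule interior_closed_Un_empty_interior)
        (use insert arc_edge in \<open>auto simp: closed_arc_image\<close>)
    then show ?case using insert interior_arc_image arc_edge by auto
  qed
qed

text \<open>Lets sample points of faces be moved off the entire drawing.\<close>

lemma open_avoids_drawn:
  assumes "F \<subseteq> E" "open U" "U \<noteq> {}"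
  obtains z where "z \<in> U" "z \<notin> drawn F"
  using assms interior_drawn[of F] interior_maximal[of U "drawn F"] by blast

lemma edge_Int_drawn:
  assumes "e \<in> E" "F \<subseteq> E" "e \<notin> F"
  shows "arc_of e \<inter> drawn F \<subseteq> pt ` (e \<inter> \<Union>F)"
  using assms edge_Int_edge by (fastforce simp: drawn_def)

lemma edge_Int_drawn_ends:
  assumes "e \<in> E" "F \<subseteq> E" "e \<notin> F"
  shows "arc_of e \<inter> drawn F \<subseteq> {pathstart (\<gamma> e), pathfinish (\<gamma> e)}"
  using edge_Int_drawn[OF assms] ends_edge[OF assms(1)] by blast

lemma edge_not_separating:
  assumes "e \<in> E" "a \<notin> arc_of e" "b \<notin> arc_of e"
  shows "connected_component (- arc_of e) a b"
proof -
  have "connected (- arc_of e)"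
    using assms arc_edge connected_arc_complement by (metis DIM_complex order_refl)
  then show ?thesis using assms by (auto simp: connected_component_def)
qed

section \<open>Separating edge sets, bridges and Jordan curves\<close>

text \<open>If \<open>x\<close> were an end vertex, \<open>e\<close> would meet the other edges in
  at most one point. Neither \<open>e\<close> nor the rest separates \<open>a\<close> from
  \<open>b\<close>, so by Janiszewski's theorem their union would not either.\<close>

lemma minimal_separating_degree:
  assumes F: "F \<subseteq> E" and sep: "\<not> connected_component (- drawn F) a b"
    and out: "a \<notin> drawn F" "b \<notin> drawn F"
    and min: "\<And>e. e \<in> F \<Longrightarrow> connected_component (- drawn (F - {e})) a b"
    and e: "e \<in> F" "x \<in> e"
  shows "\<exists>f\<in>F. f \<noteq> e \<and> x \<in> f"
proof (rule ccontr)
  assume no: "\<not> ?thesis"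
  have eE: "e \<in> E" using e F by auto
  obtain y where y: "e = {x, y}"
    using card_edge[OF eE] e by (metis card_2_iff insert_commute insertE singletonD)
  have "arc_of e \<inter> drawn (F - {e}) \<subseteq> {pt y}"
    using edge_Int_drawn[of e "F - {e}"] eE F no y by auto
  then have "connected (arc_of e \<inter> drawn (F - {e}))"
    by (rule connected_subset_singleton)
  moreover have "a \<notin> arc_of e" "b \<notin> arc_of e" using out e by (auto simp: drawn_def)
  ultimately have "connected_component (- (arc_of e \<union> drawn (F - {e}))) a b"
    using eE F e min by (intro Janiszewski edge_not_separating closed_drawn)
       (auto simp: arc_edge compact_arc_image)
  then show False using sep drawn_remove[OF e(1)] by simp
qed

text \<open>Arcs are path connected, so each remaining arc lies inside the path component of the
  start of \<open>e\<close> or misses it; \<open>F1\<close> collects the former.\<close>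

lemma bridge_split:
  assumes F: "F \<subseteq> E" and e: "e \<in> F"
    and br: "\<not> path_component (drawn (F - {e})) (pathstart (\<gamma> e)) (pathfinish (\<gamma> e))"
  obtains F1 F2 where "F1 \<union> F2 = F - {e}" "F1 \<inter> F2 = {}" "drawn F1 \<inter> drawn F2 = {}"
    "pathfinish (\<gamma> e) \<notin> drawn F1" "pathstart (\<gamma> e) \<notin> drawn F2"
proof -
  let ?X = "drawn (F - {e})" and ?u = "pathstart (\<gamma> e)"
  define F1 where "F1 = {f \<in> F - {e}. arc_of f \<subseteq> path_component_set ?X ?u}"
  have absorb: "f \<in> F1" if "f \<in> F - {e}" "z \<in> arc_of f" "z \<in> path_component_set ?X ?u" for f z
  proof -
    have "path_connected (arc_of f)" "arc_of f \<subseteq> ?X"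
      using that F arc_edge by (auto simp: drawn_def arc_imp_path path_connected_path_image)
    then have "arc_of f \<subseteq> path_component_set ?X z"
      using that by (simp add: path_component_maximal)
    also have "\<dots> = path_component_set ?X ?u"
      using that by (metis path_component_eq)
    finally show ?thesis using that by (auto simp: F1_def)
  qed
  have sub: "drawn F1 \<subseteq> path_component_set ?X ?u"
    by (auto simp: F1_def drawn_def)
  show thesis
  proof
    show "F1 \<union> (F - {e} - F1) = F - {e}" "F1 \<inter> (F - {e} - F1) = {}"
      by (auto simp: F1_def)
    show "drawn F1 \<inter> drawn (F - {e} - F1) = {}"
      using sub absorb unfolding drawn_def by blast
    show "pathfinish (\<gamma> e) \<notin> drawn F1" using sub br by auto
    show "?u \<notin> drawn (F - {e} - F1)"
    proof
      assume "?u \<in> drawn (F - {e} - F1)"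
      then obtain f where f: "f \<in> F - {e}" "f \<notin> F1" "?u \<in> arc_of f"
        by (auto simp: drawn_def)
      then have "?u \<in> ?X" by (auto simp: drawn_def)
      then show False using absorb f by (simp add: path_component_refl)
    qed
  qed
qed

text \<open>If \<open>e\<close> were a bridge, \<open>F1\<close>, \<open>e\<close> and
  \<open>F2\<close> would be glued at single points at most; Janiszewski's theorem, applied twice,
  would show that \<open>F\<close> does not separate \<open>a\<close> from \<open>b\<close>.\<close>

lemma merging_edge_has_detour:
  assumes F: "F \<subseteq> E" and e: "e \<in> F"
    and sep: "\<not> connected_component (- drawn F) a b"
    and out: "a \<notin> drawn F" "b \<notin> drawn F"
    and con: "connected_component (- drawn (F - {e})) a b"
  shows "path_component (drawn (F - {e})) (pathstart (\<gamma> e)) (pathfinish (\<gamma> e))"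
proof (rule ccontr)
  assume "\<not> ?thesis"
  then obtain F1 F2 where F12: "F1 \<union> F2 = F - {e}" "F1 \<inter> F2 = {}" "drawn F1 \<inter> drawn F2 = {}"
    "pathfinish (\<gamma> e) \<notin> drawn F1" "pathstart (\<gamma> e) \<notin> drawn F2"
    using bridge_split F e by metis
  have eE: "e \<in> E" and F1: "F1 \<subseteq> E" "e \<notin> F1" and F2: "F2 \<subseteq> E" "e \<notin> F2"
    using F e F12 by auto
  have con1: "connected_component (- drawn F1) a b" and con2: "connected_component (- drawn F2) a b"
    using con by (rule connected_component_of_subset; use F12(1) drawn_Un[of F1 F2] in auto)+
  have "a \<notin> arc_of e" "b \<notin> arc_of e" using out e by (auto simp: drawn_def)
  moreover have "arc_of e \<inter> drawn F1 \<subseteq> {pathstart (\<gamma> e)}"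
    using edge_Int_drawn_ends[OF eE F1] F12 by auto
  ultimately have c1: "connected_component (- (arc_of e \<union> drawn F1)) a b"
    using eE F1 con1
    by (intro Janiszewski edge_not_separating closed_drawn connected_subset_singleton)
       (auto simp: arc_edge compact_arc_image)
  have "(arc_of e \<union> drawn F1) \<inter> drawn F2 \<subseteq> {pathfinish (\<gamma> e)}"
    using edge_Int_drawn_ends[OF eE F2] F12 by auto
  then have "connected ((arc_of e \<union> drawn F1) \<inter> drawn F2)"
    by (rule connected_subset_singleton)
  moreover have "compact (arc_of e \<union> drawn F1)"
    using eE F1 by (simp add: arc_edge compact_arc_image compact_Un compact_drawn)
  ultimately have "connected_component (- ((arc_of e \<union> drawn F1) \<union> drawn F2)) a b"
    using Janiszewski closed_drawn[OF F2(1)] c1 con2 by blast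
  moreover have "drawn F = (arc_of e \<union> drawn F1) \<union> drawn F2"
    using drawn_remove[OF e] F12(1) by (metis drawn_Un sup_assoc)
  ultimately show False using sep by simp
qed

text \<open>The detour contains an arc \<open>g\<close> between the ends of \<open>e\<close>, and
  \<open>e\<close> with \<open>g\<close> forms a Jordan curve. It meets the other edges exactly in
  \<open>g\<close>, which is connected, as Janiszewski's theorem demands.\<close>

lemma detour_loop:
  assumes F: "F \<subseteq> E" and e: "e \<in> F"
    and detour: "path_component (drawn (F - {e})) (pathstart (\<gamma> e)) (pathfinish (\<gamma> e))"
  obtains c where "simple_path c" "pathfinish c = pathstart c" "arc_of e \<subseteq> path_image c"
    "path_image c \<union> drawn (F - {e}) = drawn F" "connected (path_image c \<inter> drawn (F - {e}))"
proof -
  let ?X = "drawn (F - {e})"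
  have eE: "e \<in> E" using F e by auto
  note arc = arc_edge[OF eE]
  obtain p where p: "path p" "path_image p \<subseteq> ?X" "pathstart p = pathfinish (\<gamma> e)"
      "pathfinish p = pathstart (\<gamma> e)"
    using path_component_sym[OF detour] by (auto simp: path_component_def)
  obtain g where g: "arc g" "path_image g \<subseteq> ?X" "pathstart g = pathfinish (\<gamma> e)"
      "pathfinish g = pathstart (\<gamma> e)"
    using path_contains_arc[OF p(1,3,4)] arc_distinct_ends[OF arc] p(2) by (metis order_trans)
  have ends: "arc_of e \<inter> ?X \<subseteq> {pathstart (\<gamma> e), pathfinish (\<gamma> e)}"
    using edge_Int_drawn_ends[of e "F - {e}"] eE F by auto
  have endsg: "{pathstart (\<gamma> e), pathfinish (\<gamma> e)} \<subseteq> path_image g"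
    using g by (metis empty_subsetI insert_subset pathfinish_in_path_image pathstart_in_path_image)
  have pi: "path_image (\<gamma> e +++ g) = arc_of e \<union> path_image g"
    using g by (simp add: path_image_join)
  show thesis
  proof
    show "simple_path (\<gamma> e +++ g)"
      using ends g arc by (intro simple_path_join_loop) auto
    show "pathfinish (\<gamma> e +++ g) = pathstart (\<gamma> e +++ g)" using g by simp
    show "arc_of e \<subseteq> path_image (\<gamma> e +++ g)" using pi by auto
    show "path_image (\<gamma> e +++ g) \<union> ?X = drawn F"
      using pi g drawn_remove[OF e] by auto
    have "path_image (\<gamma> e +++ g) \<inter> ?X = path_image g"
      using pi g ends endsg by auto
    then show "connected (path_image (\<gamma> e +++ g) \<inter> ?X)"
      using g by (simp add: connected_arc_image)
  qed
qed

text \<open>Two of the three points lie on the same side of the Jordan curve \<open>J\<close>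
  through \<open>e\<close>. They are separated neither by \<open>J\<close> nor by the other edges,
  hence by Janiszewski's theorem not by \<open>F\<close>.\<close>

lemma edge_two_sides:
  assumes F: "F \<subseteq> E" and e: "e \<in> F"
    and detour: "path_component (drawn (F - {e})) (pathstart (\<gamma> e)) (pathfinish (\<gamma> e))"
    and out: "a \<notin> drawn F" "b \<notin> drawn F" "c \<notin> drawn F"
    and con: "connected_component (- drawn (F - {e})) a b" "connected_component (- drawn (F - {e})) b c"
  shows "connected_component (- drawn F) a b \<or> connected_component (- drawn F) b c \<or>
    connected_component (- drawn F) a c"
proof -
  let ?X = "drawn (F - {e})"
  obtain J where J: "simple_path J" "pathfinish J = pathstart J" "arc_of e \<subseteq> path_image J"
    "path_image J \<union> ?X = drawn F" "connected (path_image J \<inter> ?X)"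
    using detour_loop[OF F e detour] by blast
  note Jordan = Jordan_inside_outside[OF J(1,2)]
  have same: "connected_component (- drawn F) x y"
    if "S = inside (path_image J) \<or> S = outside (path_image J)" "x \<in> S" "y \<in> S"
       "connected_component (- ?X) x y" for x y S
  proof -
    have "connected S" using that Jordan by auto
    moreover have "S \<subseteq> - path_image J"
      using that(1) inside_Un_outside[of "path_image J"] by blast
    ultimately
    have "connected_component (- path_image J) x y"
      using that by (auto simp: connected_component_def)
    then have "connected_component (- (path_image J \<union> ?X)) x y"
      using that J F by (intro Janiszewski closed_drawn) (auto simp: compact_simple_path_image)
    then show ?thesis using J by simp
  qed
  have "{a, b, c} \<subseteq> inside (path_image J) \<union> outside (path_image J)"
    using out J(4) inside_Un_outside[of "path_image J"] by blast
  moreover have "connected_component (- ?X) a c"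
    using con connected_component_trans by metis
  ultimately show ?thesis
    using same[OF disjI1[OF refl]] same[OF disjI2[OF refl]] con by blast
qed

text \<open>A small ball around an inner point of \<open>e\<close> avoids the other edges of
  \<open>F\<close> and meets both sides of the Jordan curve. The points are chosen off all of
  \<open>drawn E\<close>, so that they stay usable when \<open>F\<close> varies.\<close>

lemma detour_separates:
  assumes F: "F \<subseteq> E" and e: "e \<in> F"
    and detour: "path_component (drawn (F - {e})) (pathstart (\<gamma> e)) (pathfinish (\<gamma> e))"
  obtains a b where "a \<notin> drawn E" "b \<notin> drawn E" "connected_component (- drawn (F - {e})) a b"
    "\<not> connected_component (- drawn F) a b"
proof -
  let ?X = "drawn (F - {e})"
  have eE: "e \<in> E" using F e by auto
  obtain J where J: "simple_path J" "pathfinish J = pathstart J" "arc_of e \<subseteq> path_image J"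
    "path_image J \<union> ?X = drawn F"
    using detour_loop[OF F e detour] by metis
  note Jordan = Jordan_inside_outside[OF J(1,2)]
  obtain p where p: "p \<in> arc_of e" "p \<notin> {pathstart (\<gamma> e), pathfinish (\<gamma> e)}"
    using nonempty_simple_path_endless[OF arc_imp_simple_path[OF arc_edge[OF eE]]] by blast
  then have "p \<in> - ?X" using edge_Int_drawn_ends[of e "F - {e}"] eE F by auto
  moreover have "open (- ?X)" using open_Compl_drawn[of "F - {e}"] F by auto
  ultimately obtain r where r: "r > 0" "ball p r \<subseteq> - ?X"
    using open_contains_ball by blast
  have near: "\<exists>z\<in>S \<inter> ball p r. z \<notin> drawn E"
    if "S = inside (path_image J) \<or> S = outside (path_image J)" for S
  proof -
    have "p \<in> frontier S" "open S" using that Jordan J p by auto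
    then have "p \<in> closure S" by (simp add: frontier_def)
    then have "S \<inter> ball p r \<noteq> {}"
      using r(1) by (metis centre_in_ball disjoint_iff_not_equal open_Int_closure_eq_empty open_ball inf_commute)
    then show ?thesis
      using open_avoids_drawn[of E "S \<inter> ball p r"] \<open>open S\<close> by blast
  qed
  obtain a b where ab: "a \<in> inside (path_image J)" "a \<in> ball p r" "a \<notin> drawn E"
      "b \<in> outside (path_image J)" "b \<in> ball p r" "b \<notin> drawn E"
    using near[OF disjI1[OF refl]] near[OF disjI2[OF refl]] by blast
  show thesis
  proof
    show "connected_component (- ?X) a b"
      using r ab connected_ball unfolding connected_component_def by blast
    show "\<not> connected_component (- drawn F) a b"
    proof
      assume "connected_component (- drawn F) a b"
      then have "connected_component (- path_image J) a b"
        by (rule connected_component_of_subset) (use J in auto)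
      then show False using inside_same_component ab Jordan by blast
    qed
  qed (use ab in auto)
qed


section \<open>Edges on the boundary of a face\<close>

text \<open>The face boundary is described by deletion rather than by closures: these are the edges
  whose removal merges the face of \<open>a\<close> with a different face.\<close>

definition bounding :: "complex \<Rightarrow> 'a set set" where
  "bounding a = {e \<in> E. \<exists>b. b \<notin> drawn E \<and> connected_component (- drawn (E - {e})) a b \<and>
     \<not> connected_component (- drawn E) a b}"

text \<open>A clopen argument: within the region that the bounding edges leave around
  \<open>a\<close>, the closure of the face \<open>U\<close> of \<open>a\<close> is also open,
  because crossing any other edge leads back into \<open>U\<close>. So \<open>U\<close> would reach
  \<open>b\<close>.\<close>

lemma bounding_separates:
  assumes a: "a \<notin> drawn E" and b: "b \<notin> drawn E" and sep: "\<not> connected_component (- drawn E) a b"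
  shows "\<not> connected_component (- drawn (bounding a)) a b"
proof
  assume con: "connected_component (- drawn (bounding a)) a b"
  have sub: "bounding a \<subseteq> E" by (auto simp: bounding_def)
  define U where "U = connected_component_set (- drawn E) a"
  \<comment> \<open>Removing finitely many points keeps an open connected subset of the plane
    connected, and every point of \<open>Y\<close> lies on at most one arc.\<close>
  define Y where "Y = connected_component_set (- drawn (bounding a)) a - pt ` \<Union>E"
  have fin: "finite (\<Union>E)"
    using graph finite_subset[of "\<Union>E" V] edge_subset by (auto simp: fin_simple_graph_def)
  have openY: "open Y"
    unfolding Y_def using sub fin by (intro open_Diff open_connected_component open_Compl_drawn)
      (auto intro: finite_imp_closed)
  have conY: "connected Y"
    unfolding Y_def using sub fin
    by (intro connected_open_delete_finite open_connected_component open_Compl_drawn) auto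
  have vert: "pt ` \<Union>E \<subseteq> drawn E"
    using pt_in_edge_iff edge_subset by (fastforce simp: drawn_def)
  have aY: "a \<in> Y" and bY: "b \<in> Y"
    using vert a b con sub drawn_mono[OF sub] by (auto simp: Y_def)
  have aU: "a \<in> U" using a by (simp add: U_def)
  have clU: "closure U \<inter> - drawn E \<subseteq> U"
  proof -
    have "closedin (top_of_set (- drawn E)) U"
      unfolding U_def by (rule closedin_connected_component)
    then obtain T where "closed T" "U = - drawn E \<inter> T" by (auto simp: closedin_closed)
    then show ?thesis using closure_minimal[of U T] by blast
  qed
  have openU: "open U" unfolding U_def by (simp add: open_connected_component open_Compl_drawn)
  have nbhd: "\<exists>r>0. ball q r \<subseteq> closure U \<inter> Y" if q: "q \<in> closure U \<inter> Y" for q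
  proof (cases "q \<in> drawn E")
    case False
    then have "q \<in> U \<inter> Y" using clU q by auto
    then obtain r where "r > 0" "ball q r \<subseteq> U \<inter> Y"
      using openU openY open_Int open_contains_ball by metis
    then show ?thesis using closure_subset by blast
  next
    case True
    then obtain e where e: "e \<in> E" "q \<in> arc_of e" by (auto simp: drawn_def)
    let ?X = "drawn (E - {e})"
    have "q \<notin> drawn (bounding a)"
      using q connected_component_subset by (auto simp: Y_def)
    then have eb: "e \<notin> bounding a" using e by (auto simp: drawn_def)
    have "q \<notin> ?X"
      using edge_Int_drawn[of e "E - {e}"] e q by (auto simp: Y_def)
    moreover have "open (- ?X \<inter> Y)"
      using openY open_Compl_drawn[of "E - {e}"] by auto
    ultimately obtain r where r: "r > 0" "ball q r \<subseteq> - ?X \<inter> Y"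
      using q open_contains_ball by blast
    have "ball q r \<inter> U \<noteq> {}"
      using q r(1) by (metis IntD1 centre_in_ball disjoint_iff open_Int_closure_eq_empty open_ball)
    then obtain w where w: "w \<in> ball q r" "w \<in> U" by blast
    \<comment> \<open>The ball meets no arc except \<open>e\<close>, so \<open>w\<close> and
      \<open>z\<close> are joined once \<open>e\<close> is deleted. If \<open>z\<close> were in
      another face, \<open>e\<close> would be bounding.\<close>
    have "z \<in> U" if z: "z \<in> ball q r" "z \<notin> drawn E" for z
    proof -
      have "connected_component (- ?X) w z"
        using r w z connected_ball unfolding connected_component_def by blast
      moreover have "connected_component (- ?X) a w"
        using w connected_component_of_subset[of "- drawn E" a w "- ?X"] drawn_mono[of "E - {e}" E]
        by (auto simp: U_def)
      ultimately have "connected_component (- ?X) a z"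
        using connected_component_trans by metis
      then show ?thesis using eb e z by (auto simp: bounding_def U_def)
    qed
    then have "closure (ball q r - drawn E) \<subseteq> closure U" by (intro closure_mono) blast
    moreover have "ball q r \<subseteq> closure (ball q r - drawn E)"
    proof
      fix x assume x: "x \<in> ball q r"
      show "x \<in> closure (ball q r - drawn E)"
      proof (rule closure_iff_nhds_not_empty[THEN iffD2], intro allI impI)
        fix A S :: "complex set" assume "S \<subseteq> A" "open S" "x \<in> S"
        then show "(ball q r - drawn E) \<inter> A \<noteq> {}"
          using open_avoids_drawn[of E "S \<inter> ball q r"] x by blast
      qed
    qed
    ultimately have "ball q r \<subseteq> closure U" by blast
    then show ?thesis using r by (intro exI[of _ r]) simp
  qed
  have "open (closure U \<inter> Y)" using nbhd open_contains_ball by blast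
  then have "openin (top_of_set Y) (closure U \<inter> Y)" by (simp add: open_subset)
  moreover have "closedin (top_of_set Y) (closure U \<inter> Y)"
    by (metis closed_closure closedin_closed_Int inf_commute)
  moreover have "closure U \<inter> Y \<noteq> {}" using aU aY closure_subset by blast
  ultimately have "closure U \<inter> Y = Y" using conY unfolding connected_clopen by blast
  then have "b \<in> U" using bY clU b by auto
  then show False using sep by (simp add: U_def)
qed

text \<open>After deletion of \<open>e\<close> every face that it bounds reaches the open arc
  \<open>I\<close>, which is connected and disjoint from the other edges. Hence all three points
  fall into one component, against \<open>edge_two_sides\<close>.\<close>

lemma bounding_at_most_two:
  assumes out: "a \<notin> drawn E" "b \<notin> drawn E" "c \<notin> drawn E"
    and sep: "\<not> connected_component (- drawn E) a b" "\<not> connected_component (- drawn E) b c"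
      "\<not> connected_component (- drawn E) a c"
    and e: "e \<in> bounding a" "e \<in> bounding b" "e \<in> bounding c"
  shows False
proof -
  let ?X = "drawn (E - {e})"
  have eE: "e \<in> E" using e by (auto simp: bounding_def)
  have detour: "path_component ?X (pathstart (\<gamma> e)) (pathfinish (\<gamma> e))"
    using e(1) out(1) eE by (auto simp: bounding_def intro: merging_edge_has_detour)
  then have ends: "{pathstart (\<gamma> e), pathfinish (\<gamma> e)} \<subseteq> ?X"
    using path_component_mem by auto
  define I where "I = arc_of e - {pathstart (\<gamma> e), pathfinish (\<gamma> e)}"
  have I: "connected I" "I \<subseteq> - ?X"
    using connected_simple_path_endless[OF arc_imp_simple_path[OF arc_edge[OF eE]]]
      edge_Int_drawn_ends[of e "E - {e}"] eE by (auto simp: I_def)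
  \<comment> \<open>Otherwise the component of \<open>x\<close> in \<open>- ?X\<close> would miss
    \<open>e\<close> altogether and lie in a single face of the full drawing, although it contains
    \<open>y\<close> from another face.\<close>
  have reach: "\<exists>q\<in>I. connected_component (- ?X) x q" if x: "e \<in> bounding x" "x \<notin> drawn E" for x
  proof (rule ccontr)
    assume no: "\<not> ?thesis"
    obtain y where y: "connected_component (- ?X) x y" "\<not> connected_component (- drawn E) x y"
      using x by (auto simp: bounding_def)
    let ?K = "connected_component_set (- ?X) x"
    have "?K \<inter> ?X = {}" using connected_component_subset[of "- ?X" x] by blast
    then have "?K \<subseteq> - drawn E"
      using no ends drawn_remove[OF eE] by (auto simp: I_def)
    moreover have "x \<in> ?K" using y connected_component_in by fastforce
    ultimately show False
      using y connected_connected_component unfolding connected_component_def by blast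
  qed
  have joined: "connected_component (- ?X) x y"
    if x: "e \<in> bounding x" "x \<notin> drawn E" and y: "e \<in> bounding y" "y \<notin> drawn E" for x y
  proof -
    obtain q q' where q: "q \<in> I" "connected_component (- ?X) x q" "q' \<in> I"
        "connected_component (- ?X) y q'"
      using reach[OF x] reach[OF y] by blast
    moreover have "connected_component (- ?X) q q'"
      using I q unfolding connected_component_def by blast
    ultimately show ?thesis
      by (meson connected_component_sym connected_component_trans)
  qed
  show False
    using edge_two_sides[OF order_refl eE detour out] joined e out sep by blast
qed

section \<open>Euler's inequality\<close>

text \<open>A forest has fewer edges than vertices: a bridge splits the other edges into two parts
  with disjoint vertex sets, and each part receives one end of the bridge.\<close>

lemma all_bridges_card:
  assumes "F \<subseteq> E" "F \<noteq> {}"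
    and "\<And>e. e \<in> F \<Longrightarrow> \<not> path_component (drawn (F - {e})) (pathstart (\<gamma> e)) (pathfinish (\<gamma> e))"
  shows "card F < card (\<Union>F)"
proof -
  have "finite F" using assms(1) finite_E finite_subset by blast
  then show ?thesis using assms
  proof (induction F rule: finite_psubset_induct)
    case (psubset F)
    obtain e where e: "e \<in> F" using psubset by auto
    then have eE: "e \<in> E" using psubset by auto
    obtain F1 F2 where F12: "F1 \<union> F2 = F - {e}" "F1 \<inter> F2 = {}" "drawn F1 \<inter> drawn F2 = {}"
      "pathfinish (\<gamma> e) \<notin> drawn F1" "pathstart (\<gamma> e) \<notin> drawn F2"
      using bridge_split[OF psubset.prems(1) e psubset.prems(3)[OF e]] by metis
    obtain u v where uv: "u \<in> e" "pt u = pathstart (\<gamma> e)" "v \<in> e" "pt v = pathfinish (\<gamma> e)"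
      using ends_edge[OF eE] by (metis image_iff insertCI)
    have uvne: "u \<noteq> v" using uv arc_distinct_ends[OF arc_edge[OF eE]] by metis
    have finV: "finite (\<Union>F)"
      using psubset.prems(1) edge_subset graph finite_subset[of "\<Union>F" V] by (auto simp: fin_simple_graph_def)
    have sub: "F1 \<subseteq> F" "F2 \<subseteq> F" using F12 by auto
    have fin1: "finite (\<Union>F1)" "finite (\<Union>F2)"
      using sub finV by (meson Union_mono finite_subset)+
    have on: "pt x \<in> drawn F'" if "x \<in> \<Union>F'" "F' \<subseteq> F" for x F'
      using that pt_in_edge_iff edge_subset psubset.prems(1) by (fastforce simp: drawn_def)
    \<comment> \<open>The inserted end makes the inequality strict even for an empty part, which has
      no edges but then has one vertex.\<close>
    have part: "card F' < card (insert x (\<Union>F'))"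
      if F': "F' \<subset> F" "finite (\<Union>F')" for F' and x
    proof (cases "F' = {}")
      case False
      have "card F' < card (\<Union>F')"
      proof (rule psubset.IH[OF F'(1) _ False])
        show "F' \<subseteq> E" using F' psubset.prems(1) by auto
        fix f assume f: "f \<in> F'"
        show "\<not> path_component (drawn (F' - {f})) (pathstart (\<gamma> f)) (pathfinish (\<gamma> f))"
        proof
          assume "path_component (drawn (F' - {f})) (pathstart (\<gamma> f)) (pathfinish (\<gamma> f))"
          then have "path_component (drawn (F - {f})) (pathstart (\<gamma> f)) (pathfinish (\<gamma> f))"
            by (rule path_component_of_subset[rotated]) (use F' in \<open>auto simp: drawn_def\<close>)
          then show False using psubset.prems(3) f F' by blast
        qed
      qed
      also have "\<dots> \<le> card (insert x (\<Union>F'))" using F' by (simp add: card_insert_le)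
      finally show ?thesis .
    qed simp
    have "card F1 < card (insert u (\<Union>F1))" "card F2 < card (insert v (\<Union>F2))"
      using F12(1) e fin1 by (auto intro!: part)
    moreover have "v \<notin> \<Union>F1" "u \<notin> \<Union>F2" "\<Union>F1 \<inter> \<Union>F2 = {}"
      using on[OF _ sub(1)] on[OF _ sub(2)] F12(3-5) uv(2,4) by (metis, metis, blast)
    then have "insert u (\<Union>F1) \<inter> insert v (\<Union>F2) = {}" using uvne by blast
    then have "card (insert u (\<Union>F1)) + card (insert v (\<Union>F2)) =
        card (insert u (\<Union>F1) \<union> insert v (\<Union>F2))"
      using fin1 by (intro card_Un_disjoint[symmetric]) auto
    moreover have "\<dots> \<le> card (\<Union>F)"
      using sub uv e by (intro card_mono finV) auto
    moreover have "card F = Suc (card F1 + card F2)"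
    proof -
      have "card F = Suc (card (F - {e}))"
        using e psubset.hyps by (metis card_Suc_Diff1)
      also have "card (F - {e}) = card F1 + card F2"
        using F12(1,2) sub psubset.hyps by (metis card_Un_disjoint finite_subset)
      finally show ?thesis .
    qed
    ultimately show ?case by linarith
  qed
qed

text \<open>The direction of Euler's formula that holds without connectedness, with one sample point
  per counted face. Forests have at least one face; putting back an edge with a detour splits a face
  and adds at most new vertices.\<close>

lemma many_faces:
  assumes "F \<subseteq> E"
  shows "\<exists>A. finite A \<and> A \<inter> drawn E = {} \<and>
    (\<forall>a\<in>A. \<forall>b\<in>A. a \<noteq> b \<longrightarrow> \<not> connected_component (- drawn F) a b) \<and>
    card F + 1 \<le> card A + card (\<Union>F)"
proof -
  have "finite F" using assms(1) finite_E finite_subset by blast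
  then show ?thesis using assms
  proof (induction F rule: finite_psubset_induct)
    case (psubset F)
    show ?case
    proof (cases "\<exists>e\<in>F. path_component (drawn (F - {e})) (pathstart (\<gamma> e)) (pathfinish (\<gamma> e))")
      case False
      obtain z where "z \<notin> drawn E" using open_avoids_drawn[of E UNIV] by auto
      moreover have "card F \<le> card (\<Union>F)"
        using all_bridges_card[OF psubset.prems] False by (cases "F = {}") force+
      ultimately show ?thesis by (intro exI[of _ "{z}"]) auto
    next
      case True
      then obtain e where e: "e \<in> F"
        and detour: "path_component (drawn (F - {e})) (pathstart (\<gamma> e)) (pathfinish (\<gamma> e))" by blast
      let ?X = "drawn (F - {e})"
      obtain A where A: "finite A" "A \<inter> drawn E = {}"
        "\<forall>a\<in>A. \<forall>b\<in>A. a \<noteq> b \<longrightarrow> \<not> connected_component (- ?X) a b"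
        "card (F - {e}) + 1 \<le> card A + card (\<Union>(F - {e}))"
        using psubset.IH[of "F - {e}"] psubset.prems e by auto
      obtain a b where ab: "a \<notin> drawn E" "b \<notin> drawn E" "connected_component (- ?X) a b"
        "\<not> connected_component (- drawn F) a b"
        using detour_separates[OF psubset.prems e detour] by blast
      \<comment> \<open>The points \<open>a\<close> and \<open>b\<close> represent the halves of the
        split face and replace the sample point of that face, of which \<open>A\<close> has at most
        one; so the number grows by at least one.\<close>
      define A' where "A' = insert a (insert b {x \<in> A. \<not> connected_component (- ?X) a x})"
      have sep: "\<not> connected_component (- drawn F) x y" if "\<not> connected_component (- ?X) x y" for x y
        using that connected_component_of_subset[of "- drawn F" x y "- ?X"] drawn_mono[of "F - {e}" F]
        by (meson Compl_anti_mono Diff_subset)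
      have "card (\<Union>(F - {e})) \<le> card (\<Union>F)"
        using psubset.prems edge_subset graph finite_subset[of "\<Union>F" V]
        by (intro card_mono) (auto simp: fin_simple_graph_def)
      moreover have "card F = Suc (card (F - {e}))"
        using e psubset.hyps by (metis card_Suc_Diff1)
      moreover have "Suc (card A) \<le> card A'"
      proof -
        let ?B = "{x \<in> A. \<not> connected_component (- ?X) a x}" and ?C = "{x \<in> A. connected_component (- ?X) a x}"
        have "x = y" if "x \<in> ?C" "y \<in> ?C" for x y
          using that A(3) by (metis (no_types, lifting) connected_component_sym connected_component_trans mem_Collect_eq)
        then have "card ?C \<le> 1"
          using A(1) by (auto simp: card_le_Suc0_iff_eq)
        moreover have "card A = card ?B + card ?C"
        proof -
          have "card (?B \<union> ?C) = card ?B + card ?C"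
            using A(1) by (intro card_Un_disjoint) auto
          moreover have "?B \<union> ?C = A" by auto
          ultimately show ?thesis by simp
        qed
        moreover have "a \<noteq> b" "a \<notin> ?B" "b \<notin> ?B"
        proof -
          have "connected_component (- ?X) a a"
            using ab(3) connected_component_in connected_component_refl by metis
          then show "a \<notin> ?B" "b \<notin> ?B" using ab(3) by simp_all
          show "a \<noteq> b"
            using ab psubset.prems drawn_mono[of F E] by auto
        qed
        then have "card A' = card ?B + 2"
          using A(1) by (simp add: A'_def)
        ultimately show ?thesis by linarith
      qed
      ultimately have "card F + 1 \<le> card A' + card (\<Union>F)" using A(4) by linarith
      moreover have "\<not> connected_component (- drawn F) x y" if xy: "x \<in> A'" "y \<in> A'" "x \<noteq> y" for x y
      proof -
        have far: "\<not> connected_component (- drawn F) p q \<and> \<not> connected_component (- drawn F) q p"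
          if "p \<in> {a, b}" "\<not> connected_component (- ?X) a q" for p q
        proof -
          have "connected_component (- ?X) a p \<or> p = a" using that ab(3) by auto
          then have "\<not> connected_component (- ?X) p q"
            using that(2) connected_component_trans by metis
          then show ?thesis using sep connected_component_sym by metis
        qed
        consider "x \<in> {a, b}" "y \<in> {a, b}" | "x \<in> {a, b}" "\<not> connected_component (- ?X) a y"
          | "y \<in> {a, b}" "\<not> connected_component (- ?X) a x" | "x \<in> A" "y \<in> A"
          using xy by (auto simp: A'_def)
        then show ?thesis
        proof cases
          case 1
          then show ?thesis using xy(3) ab(4) connected_component_sym by fast
        next
          case 4
          then show ?thesis using xy(3) A(3) sep by blast
        qed (use far in blast)+
      qed
      ultimately show ?thesis
        using A ab by (intro exI[of _ A']) (auto simp: A'_def)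
    qed
  qed
qed

section \<open>The edge bound for plane graphs without triangles\<close>

text \<open>A separating subset of least size has no end vertices, so it contains a walk
  \<open>y\<close>, \<open>v\<close>, \<open>u\<close>, \<open>x\<close>, \<open>z\<close>. Its four
  edges are distinct, also when it closes up with \<open>z = y\<close>.\<close>

lemma separating_card_ge_4:
  assumes tri: "\<And>x y z. {x, y} \<in> E \<Longrightarrow> {y, z} \<in> E \<Longrightarrow> {x, z} \<notin> E"
    and F: "F \<subseteq> E" and out: "a \<notin> drawn E" "b \<notin> drawn E"
    and sep: "\<not> connected_component (- drawn F) a b"
  shows "4 \<le> card F"
proof -
  have finF: "finite F" using F finite_E finite_subset by blast
  define P where "P H \<longleftrightarrow> H \<subseteq> F \<and> \<not> connected_component (- drawn H) a b" for H
  have "P F" using sep by (auto simp: P_def)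
  then obtain H where H: "P H" "\<And>H'. P H' \<Longrightarrow> card H \<le> card H'"
    using ex_has_least_nat[of P F card] by blast
  have HF: "H \<subseteq> F" and HE: "H \<subseteq> E" and finH: "finite H"
    using H F finF finite_subset by (auto simp: P_def)
  have min: "connected_component (- drawn (H - {e})) a b" if "e \<in> H" for e
    using that H(2)[of "H - {e}"] HF card_Diff1_less[OF finH that] by (auto simp: P_def)
  have outH: "a \<notin> drawn H" "b \<notin> drawn H" using out drawn_mono[OF HE] by auto
  have deg: "\<exists>f\<in>H. f \<noteq> e \<and> x \<in> f" if "e \<in> H" "x \<in> e" for e x
    by (rule minimal_separating_degree[of H a b e x]) (use HE H(1) outH min that in \<open>auto simp: P_def\<close>)
  have deg': "\<exists>z. z \<noteq> y \<and> z \<noteq> x \<and> {x, z} \<in> H" if xy: "{x, y} \<in> H" for x y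
  proof -
    obtain f where f: "f \<in> H" "f \<noteq> {x, y}" "x \<in> f" using deg[OF xy] by auto
    then obtain z where "f = {x, z}" "z \<noteq> x"
      using card_edge[of f] HE by (metis card_2_iff doubleton_eq_iff insertE singletonD subsetD)
    then show ?thesis using f by auto
  qed
  have "H \<noteq> {}" using H(1) connected_component_UNIV by (fastforce simp: P_def)
  then obtain e where "e \<in> H" by blast
  moreover from this obtain u v where "e = {u, v}" "u \<noteq> v"
    using card_edge HE by (metis card_2_iff subsetD)
  ultimately have uv: "{u, v} \<in> H" "u \<noteq> v" by auto
  obtain x where x: "x \<noteq> v" "x \<noteq> u" "{u, x} \<in> H" using deg'[OF uv(1)] by blast
  obtain y where y: "y \<noteq> u" "y \<noteq> v" "{v, y} \<in> H" using deg'[of v u] uv(1) by (auto simp: insert_commute)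
  \<comment> \<open>Equality would close the triangle on \<open>u\<close>, \<open>v\<close>,
    \<open>x\<close>.\<close>
  have xy: "x \<noteq> y" using tri[of u v y] uv x y HE by auto
  obtain z where z: "z \<noteq> u" "z \<noteq> x" "{x, z} \<in> H" using deg'[of x u] x by (auto simp: insert_commute)
  have "card {{u, v}, {u, x}, {v, y}, {x, z}} = 4"
    using uv x y z xy by (auto simp: doubleton_eq_iff card_insert_if)
  moreover have "card {{u, v}, {u, x}, {v, y}, {x, z}} \<le> card F"
    using uv x y z HF by (intro card_mono finF) auto
  ultimately show ?thesis by simp
qed

text \<open>Each counted face has at least four bounding edges and each edge bounds at most two of
  them, so \<open>4 * card A \<le> 2 * card E\<close>; Euler's inequality gives the rest. The face
  count needs a second face, so at most one sample point is a separate case.\<close>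

lemma triangle_free_card_edges:
  assumes tri: "\<And>x y z. {x, y} \<in> E \<Longrightarrow> {y, z} \<in> E \<Longrightarrow> {x, z} \<notin> E"
    and ne: "V \<noteq> {}"
  shows "card E < 2 * card V"
proof -
  have finV: "finite V" using graph by (simp add: fin_simple_graph_def)
  have UV: "card (\<Union>E) \<le> card V"
    using finV edge_subset by (intro card_mono) auto
  have V0: "card V > 0" using finV ne by auto
  obtain A where A: "finite A" "A \<inter> drawn E = {}"
    "\<forall>a\<in>A. \<forall>b\<in>A. a \<noteq> b \<longrightarrow> \<not> connected_component (- drawn E) a b"
    "card E + 1 \<le> card A + card (\<Union>E)"
    using many_faces[of E] by blast
  show ?thesis
  proof (cases "card A \<le> 1")
    case True
    then show ?thesis using A(4) UV V0 by linarith
  next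
    case False
    have "4 * card A \<le> (\<Sum>a\<in>A. card {e \<in> E. e \<in> bounding a})"
    proof -
      have "4 \<le> card {e \<in> E. e \<in> bounding a}" if a: "a \<in> A" for a
      proof -
        obtain b where b: "b \<in> A" "b \<noteq> a"
          using False a A(1) by (metis card_le_Suc0_iff_eq One_nat_def)
        have "4 \<le> card (bounding a)"
          using A(2,3) a b
          by (intro separating_card_ge_4[OF tri, where a=a and b=b] bounding_separates) (auto simp: bounding_def)
        moreover have "{e \<in> E. e \<in> bounding a} = bounding a" by (auto simp: bounding_def)
        ultimately show ?thesis by simp
      qed
      then show ?thesis using sum_bounded_below[of A 4 "\<lambda>a. card {e \<in> E. e \<in> bounding a}"] by simp
    qed
    also have "\<dots> = (\<Sum>e\<in>E. card {a \<in> A. e \<in> bounding a})"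
      using A(1) finite_E by (intro sum_multicount_gen) auto
    also have "\<dots> \<le> (\<Sum>e\<in>E. 2)"
    proof (rule sum_mono, rule ccontr)
      fix e assume "\<not> card {a \<in> A. e \<in> bounding a} \<le> 2"
      then have "3 \<le> card {a \<in> A. e \<in> bounding a}" by simp
      then obtain T where "T \<subseteq> {a \<in> A. e \<in> bounding a}" "card T = 3"
        using obtain_subset_with_card_n by metis
      then obtain a b c where "{a, b, c} \<subseteq> {a \<in> A. e \<in> bounding a}" "a \<noteq> b" "b \<noteq> c" "a \<noteq> c"
        by (auto simp: card_3_iff)
      then show False using bounding_at_most_two[of a b c e] A(2,3) by blast
    qed
    finally show ?thesis using A(4) UV by simp
  qed
qed

end

section \<open>Planar graphs of girth at least four\<close>

lemma girth_ge_4_triangle_free: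
  assumes G: "fin_simple_graph V E" and girth: "girth E \<ge> 4"
    and E: "{x, y} \<in> E" "{y, z} \<in> E"
  shows "{x, z} \<notin> E"
proof
  assume xz: "{x, z} \<in> E"
  have "card {x, y} = 2" "card {y, z} = 2" "card {x, z} = 2"
    using G E xz by (auto simp: fin_simple_graph_def)
  then have "x \<noteq> y" "y \<noteq> z" "x \<noteq> z" by auto
  moreover have "{z, x} \<in> E" using xz by (simp add: insert_commute)
  moreover have "{[x, y, z] ! i, [x, y, z] ! (Suc i mod 3)} \<in> E" if i: "i < 3" for i
  proof -
    consider "i = 0" | "i = 1" | "i = 2" using i by linarith
    then show ?thesis using E \<open>{z, x} \<in> E\<close> by cases simp_all
  qed
  ultimately have "is_cycle E [x, y, z]" by (simp add: is_cycle_def)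
  then have "girth E \<le> enat (length [x, y, z])"
    unfolding girth_def by (intro INF_lower) simp
  then have "(4::enat) \<le> enat 3" using girth order_trans by fastforce
  then show False by (simp add: numeral_eq_enat)
qed

text \<open>The edge bound is required for every induced subgraph; the drawing restricts to
  \<open>W\<close>, and so does the absence of triangles.\<close>

lemma planar_triangle_free_sparse:
  assumes G: "fin_simple_graph V E" and planar: "planar V E" and girth: "girth E \<ge> 4"
    and W: "W \<subseteq> V" "W \<noteq> {}"
  shows "card {e \<in> E. e \<subseteq> W} < 2 * card W"
proof -
  obtain pt \<gamma> where d: "plane_drawing V E pt \<gamma>" using planar by (auto simp: planar_def)
  interpret plane_graph W "{e \<in> E. e \<subseteq> W}" pt \<gamma>
  proof
    show "fin_simple_graph W {e \<in> E. e \<subseteq> W}"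
      using G W finite_subset by (auto simp: fin_simple_graph_def)
    have "path_image (\<gamma> e) \<inter> pt ` W = pt ` e" if "e \<in> E" "e \<subseteq> W" for e
    proof -
      have "path_image (\<gamma> e) \<inter> pt ` V = pt ` e" using d that by (simp add: plane_drawing_def)
      then show ?thesis using W(1) that(2) by blast
    qed
    moreover have "inj_on pt W" using d W by (auto simp: plane_drawing_def intro: inj_on_subset)
    ultimately show "plane_drawing W {e \<in> E. e \<subseteq> W} pt \<gamma>"
      using d by (auto simp: plane_drawing_def)
  qed
  show ?thesis
    using girth_ge_4_triangle_free[OF G girth] W by (intro triangle_free_card_edges) auto
qed

theorem theorem12:
  fixes V :: "'a set" and E :: "'a set set"
  assumes "fin_simple_graph V E"
  shows "(planar V E \<and> girth E \<ge> 4 \<longrightarrow> corr_packing_number V E \<le> 5) \<and>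
         (max_avg_degree V E < 4 \<longrightarrow> corr_packing_number V E \<le> 5)"
proof (intro conjI impI)
  assume "planar V E \<and> girth E \<ge> 4"
  then show "corr_packing_number V E \<le> 5"
    using planar_triangle_free_sparse[OF assms]
    by (intro corr_packing_number_le_5[OF assms]) auto
next
  assume "max_avg_degree V E < 4"
  then show "corr_packing_number V E \<le> 5"
    using max_avg_degree_sparse[OF assms]
    by (intro corr_packing_number_le_5[OF assms]) auto
qed

end
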